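(* Let $a,b,c\geq 1$, let $T \in \mathbb{C}^a\otimes\mathbb{C}^b\otimes\mathbb{C}^c$ be a free tensor, and let $S \in \overline{\mathrm{GL} \cdot T} \setminus \{0\}$ be such that $\|\mu(S)\|$ is minimal among all elements of $\overline{\mathrm{GL} \cdot T} \setminus \{0\}$. Then there exists $k \in \mathrm{U}$ such that $k \cdot S$ has free support. Here $\mathrm{GL}=\mathrm{GL}_a(\mathbb{C})\times\mathrm{GL}_b(\mathbb{C})\times\mathrm{GL}_c(\mathbb{C})$, $\mathrm{U}=\mathrm{U}_a\times\mathrm{U}_b\times\mathrm{U}_c$ is its subgroup of triples of unitary matrices, and $\mu$ is the moment map.
   Context: The group $\mathrm{GL}$ acts on $V=\mathbb{C}^a\otimes\mathbb{C}^b\otimes\mathbb{C}^c$ by $(A,B,C)\cdot T=(A\otimes B\otimes C)T$. The closure of an orbit is the same in the Euclidean and the Zariski topology. For $T=\sum T_{i,j,k}\,e_i\otimes e_j\otimes e_k$ in the standard bases, $\operatorname{supp}(T)=\{(i,j,k) \mid T_{i,j,k}\neq 0\}$; a set of triples is free if any two distinct elements of it differ in at least two coordinates; $T$ is free if $\operatorname{supp}(g\cdot T)$ is free for some $g\in\mathrm{GL}$. The moment map $\mu=(\mu_1,\mu_2,\mu_3)\colon V\setminus\{0\}\to \mathrm{Herm}_a\times\mathrm{Herm}_b\times\mathrm{Herm}_c$ (triples of Hermitian matrices) is defined by $\mu_1(T)_{i,\ell}=\frac{1}{\|T\|^2}\sum_{j,k}\overline{T_{i,j,k}}\,T_{\ell,j,k}$,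 and analogously $\mu_2(T)_{j,\ell}=\frac{1}{\|T\|^2}\sum_{i,k}\overline{T_{i,j,k}}\,T_{i,\ell,k}$, $\mu_3(T)_{k,\ell}=\frac{1}{\|T\|^2}\sum_{i,j}\overline{T_{i,j,k}}\,T_{i,j,\ell}$, where $\|T\|^2=\sum|T_{i,j,k}|^2$. The norm on triples of Hermitian matrices is $\|(H_1,H_2,H_3)\|^2=\sum_{i}\|H_i\|_F^2$ with $\|\cdot\|_F$ the Frobenius norm. *)

theory Defs
  imports "HOL-Analysis.Analysis"
begin

text \<open>
  A tensor is given by its coordinates \<open>T $ i $ j $ k\<close> in the standard bases, so the
  dimensions are \<open>CARD('a)\<close>, \<open>CARD('b)\<close>, \<open>CARD('c)\<close>. The library norms on these iterated
  vector types and on products are the Euclidean ones; see the lemmas at the end.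
\<close>

type_synonym ('a, 'b, 'c) tensor3 = "complex ^ 'c ^ 'b ^ 'a"

type_synonym ('a, 'b, 'c) mat_triple =
  "(complex ^ 'a ^ 'a) \<times> (complex ^ 'b ^ 'b) \<times> (complex ^ 'c ^ 'c)"

definition adjoint_matrix :: "complex ^ 'n ^ 'm \<Rightarrow> complex ^ 'm ^ 'n" where
  "adjoint_matrix A = (\<chi> i j. cnj (A $ j $ i))"

definition unitary_matrix :: "complex ^ 'n ^ 'n \<Rightarrow> bool" where
  "unitary_matrix A \<longleftrightarrow> adjoint_matrix A ** A = mat 1 \<and> A ** adjoint_matrix A = mat 1"

definition GL :: "('a::finite, 'b::finite, 'c::finite) mat_triple set" where
  "GL = {(A, B, C). invertible A \<and> invertible B \<and> invertible C}"

definition U :: "('a::finite, 'b::finite, 'c::finite) mat_triple set" where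
  "U = {(A, B, C). unitary_matrix A \<and> unitary_matrix B \<and> unitary_matrix C}"

definition act ::
  "('a::finite, 'b::finite, 'c::finite) mat_triple \<Rightarrow> ('a, 'b, 'c) tensor3 \<Rightarrow> ('a, 'b, 'c) tensor3"
  (infixr "\<bullet>\<^sub>t" 75) where
  "g \<bullet>\<^sub>t T = (case g of (A, B, C) \<Rightarrow>
     (\<chi> i j k. \<Sum>i'\<in>UNIV. \<Sum>j'\<in>UNIV. \<Sum>k'\<in>UNIV.
        A $ i $ i' * B $ j $ j' * C $ k $ k' * T $ i' $ j' $ k'))"

definition GL_orbit ::
  "('a::finite, 'b::finite, 'c::finite) tensor3 \<Rightarrow> ('a, 'b, 'c) tensor3 set" where
  "GL_orbit T = {g \<bullet>\<^sub>t T | g. g \<in> GL}"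

definition supp ::
  "('a::finite, 'b::finite, 'c::finite) tensor3 \<Rightarrow> ('a \<times> 'b \<times> 'c) set" where
  "supp T = {(i, j, k). T $ i $ j $ k \<noteq> 0}"

definition free_set :: "('a \<times> 'b \<times> 'c) set \<Rightarrow> bool" where
  "free_set F \<longleftrightarrow>
     (\<forall>(i, j, k)\<in>F. \<forall>(i', j', k')\<in>F. (i, j, k) \<noteq> (i', j', k') \<longrightarrow>
        (i \<noteq> i' \<and> j \<noteq> j') \<or> (i \<noteq> i' \<and> k \<noteq> k') \<or> (j \<noteq> j' \<and> k \<noteq> k'))"

definition free_tensor :: "('a::finite, 'b::finite, 'c::finite) tensor3 \<Rightarrow> bool" where
  "free_tensor T \<longleftrightarrow> (\<exists>g\<in>GL. free_set (supp (g \<bullet>\<^sub>t T)))"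

text \<open>The moment map is only meaningful for nonzero tensors (the value at \<open>0\<close> is junk).\<close>

definition moment_map ::
  "('a::finite, 'b::finite, 'c::finite) tensor3 \<Rightarrow> ('a, 'b, 'c) mat_triple" where
  "moment_map T =
     ((\<chi> i l. 1 / of_real ((norm T)\<^sup>2) * (\<Sum>j\<in>UNIV. \<Sum>k\<in>UNIV. cnj (T $ i $ j $ k) * T $ l $ j $ k)),
      (\<chi> j l. 1 / of_real ((norm T)\<^sup>2) * (\<Sum>i\<in>UNIV. \<Sum>k\<in>UNIV. cnj (T $ i $ j $ k) * T $ i $ l $ k)),
      (\<chi> k l. 1 / of_real ((norm T)\<^sup>2) * (\<Sum>i\<in>UNIV. \<Sum>j\<in>UNIV. cnj (T $ i $ j $ k) * T $ i $ j $ l)))"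

lemma norm_matrix_sq:
  fixes A :: "complex ^ 'n::finite ^ 'm::finite"
  shows "(norm A)\<^sup>2 = (\<Sum>i\<in>UNIV. \<Sum>j\<in>UNIV. (cmod (A $ i $ j))\<^sup>2)"
  by (simp add: norm_vec_def L2_set_def sum_nonneg)

lemma norm_tensor_sq:
  fixes T :: "('a::finite, 'b::finite, 'c::finite) tensor3"
  shows "(norm T)\<^sup>2 = (\<Sum>i\<in>UNIV. \<Sum>j\<in>UNIV. \<Sum>k\<in>UNIV. (cmod (T $ i $ j $ k))\<^sup>2)"
  by (simp add: norm_vec_def L2_set_def sum_nonneg)

lemma norm_mat_triple_sq:
  fixes H1 :: "complex ^ 'a::finite ^ 'a" and H2 :: "complex ^ 'b::finite ^ 'b"
    and H3 :: "complex ^ 'c::finite ^ 'c"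
  shows "(norm (H1, H2, H3))\<^sup>2 = (norm H1)\<^sup>2 + (norm H2)\<^sup>2 + (norm H3)\<^sup>2"
  by (simp add: norm_Pair)

lemma moment_map_hermitian:
  "adjoint_matrix (fst (moment_map T)) = fst (moment_map T)"
  "adjoint_matrix (fst (snd (moment_map T))) = fst (snd (moment_map T))"
  "adjoint_matrix (snd (snd (moment_map T))) = snd (snd (moment_map T))"
  by (simp_all add: moment_map_def adjoint_matrix_def vec_eq_iff mult.commute)

end

theory Submission
  imports Defs
begin

text \<open>
  Replace \<open>T\<close> by a tensor with free support in its orbit, and let \<open>P = (p, q, r)\<close> be the point of
  least norm in the convex hull of the weights of that support. Minimising the convex function
  \<open>h \<mapsto> \<Sum>\<^sub>\<omega> |T\<^sub>\<omega>|\<^sup>2 exp \<langle>h, \<omega> - P\<rangle>\<close> gives a unit vector \<open>R\<close> in the closure of the torus orbit of \<open>T\<close>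
  with marginals \<open>P\<close>; its support is free, so its moment map is the diagonal triple \<open>P\<close>.

  By QR factorisation and compactness of the unitary group, \<open>S\<close> is unitarily equivalent to a limit
  \<open>S1\<close> of tensors \<open>b\<^sub>n \<bullet>\<^sub>t T\<close> with \<open>b\<^sub>n\<close> block triangular with respect to \<open>P\<close>, hence supported on
  weights \<open>\<omega>\<close> with \<open>\<langle>P, \<omega>\<rangle> \<ge> |P|\<^sup>2\<close>. Since \<open>|\<mu> S1| \<le> |\<mu> R| = |P|\<close>, the Cauchy--Schwarz inequality forces
  \<open>\<mu> S1 = P\<close>, and \<open>S1\<close> lives on the face \<open>\<langle>P, \<omega>\<rangle> = |P|\<^sup>2\<close>. On that face only the block diagonal parts
  of \<open>b\<^sub>n\<close> matter, so \<open>S1\<close> and \<open>R\<close> are limits in one orbit of the centraliser of \<open>P\<close>, both with moment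
  map \<open>P\<close>. By the singular value decomposition in the centraliser they may be compared through
  positive diagonal scalings, and then a logarithm argument shows that they are unitarily equivalent.
\<close>

section \<open>Unitary matrices and reflections\<close>

text \<open>The Hermitian inner product, conjugate-linear in the first argument; the real inner
  product \<open>\<bullet>\<close> on these vectors is only its real part.\<close>

definition cinner :: "complex ^ 'n::finite \<Rightarrow> complex ^ 'n \<Rightarrow> complex" where
  "cinner x y = (\<Sum>i\<in>UNIV. cnj (x $ i) * y $ i)"

definition diag_matrix :: "('n::finite \<Rightarrow> 'a::zero) \<Rightarrow> 'a ^ 'n ^ 'n" where
  "diag_matrix d = (\<chi> i j. if i = j then d i else 0)"

lemma cinner_self: "cinner x x = of_real ((norm x)\<^sup>2)"
  by (simp add: cinner_def norm_vec_def L2_set_def sum_nonneg mult.commute[of "cnj _"]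
      complex_mult_cnj cmod_power2)

lemma cinner_commute: "cinner y x = cnj (cinner x y)"
  by (simp add: cinner_def mult.commute)

lemma cinner_add_right: "cinner x (y + z) = cinner x y + cinner x z"
  by (simp add: cinner_def algebra_simps sum.distrib)

lemma cinner_add_left: "cinner (x + y) z = cinner x z + cinner y z"
  by (simp add: cinner_def algebra_simps sum.distrib)

lemma cinner_diff_right: "cinner x (y - z) = cinner x y - cinner x z"
  by (simp add: cinner_def algebra_simps sum_subtractf)

lemma cinner_diff_left: "cinner (x - y) z = cinner x z - cinner y z"
  by (simp add: cinner_def algebra_simps sum_subtractf)

lemma cinner_scale_right: "cinner x (c *s y) = c * cinner x y"
  by (simp add: cinner_def algebra_simps sum_distrib_left)

lemma cinner_scale_left: "cinner (c *s x) y = cnj c * cinner x y"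
  by (simp add: cinner_def algebra_simps sum_distrib_left)

lemma norm_vector_scale: "norm (c *s x) = cmod c * norm (x :: complex ^ 'n::finite)"
  by (simp add: norm_vec_def L2_set_def norm_mult power_mult_distrib real_sqrt_mult flip: sum_distrib_left)

lemma norm_axis_complex: "norm (axis i (c :: complex) :: complex ^ 'n::finite) = cmod c"
  by (simp add: norm_vec_def L2_set_def axis_def if_distrib[of "\<lambda>z. (cmod z)\<^sup>2"] cong: if_cong)

lemma cinner_axis: "cinner x (axis i c) = cnj (x $ i) * c"
  by (simp add: cinner_def axis_def if_distrib[of "\<lambda>z. _ * z"] cong: if_cong)

lemma adjoint_matrix_mult: "adjoint_matrix (A ** B) = adjoint_matrix B ** adjoint_matrix A"
  by (simp add: adjoint_matrix_def matrix_matrix_mult_def vec_eq_iff mult.commute)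

lemma adjoint_adjoint_matrix [simp]: "adjoint_matrix (adjoint_matrix A) = A"
  by (simp add: adjoint_matrix_def vec_eq_iff)

lemma cinner_adjoint: "cinner (A *v x) y = cinner x (adjoint_matrix A *v y)"
proof -
  have "cinner (A *v x) y = (\<Sum>i\<in>UNIV. \<Sum>j\<in>UNIV. cnj (A $ i $ j) * cnj (x $ j) * y $ i)"
    by (simp add: cinner_def matrix_vector_mult_def sum_distrib_right)
  also have "\<dots> = (\<Sum>j\<in>UNIV. \<Sum>i\<in>UNIV. cnj (A $ i $ j) * cnj (x $ j) * y $ i)"
    by (rule sum.swap)
  also have "\<dots> = cinner x (adjoint_matrix A *v y)"
    by (simp add: cinner_def matrix_vector_mult_def adjoint_matrix_def sum_distrib_left mult_ac)
  finally show ?thesis .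
qed

lemma unitary_matrixI: "adjoint_matrix A ** A = mat 1 \<Longrightarrow> unitary_matrix A"
  by (simp add: unitary_matrix_def matrix_left_right_inverse)

lemma unitary_mult: "unitary_matrix A \<Longrightarrow> unitary_matrix B \<Longrightarrow> unitary_matrix (A ** B)"
proof (rule unitary_matrixI)
  assume A: "unitary_matrix A" and B: "unitary_matrix B"
  have "adjoint_matrix (A ** B) ** (A ** B) = adjoint_matrix B ** (adjoint_matrix A ** A) ** B"
    by (simp add: adjoint_matrix_mult matrix_mul_assoc)
  then show "adjoint_matrix (A ** B) ** (A ** B) = mat 1"
    using A B by (simp add: unitary_matrix_def)
qed

lemma unitary_adjoint: "unitary_matrix A \<Longrightarrow> unitary_matrix (adjoint_matrix A)"
  by (simp add: unitary_matrix_def)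

lemma unitary_mat_1: "unitary_matrix (mat 1)"
proof -
  have "adjoint_matrix (mat 1) = (mat 1 :: complex ^ 'n ^ 'n)"
    by (auto simp: adjoint_matrix_def mat_def vec_eq_iff)
  then show ?thesis by (simp add: unitary_matrix_def)
qed

lemma unitary_cinner: "unitary_matrix A \<Longrightarrow> cinner (A *v x) (A *v y) = cinner x y"
  by (simp add: cinner_adjoint matrix_vector_mul_assoc unitary_matrix_def)

lemma unitary_norm_mult_vec: "unitary_matrix A \<Longrightarrow> norm (A *v x) = norm x"
  using unitary_cinner[of A x x] unfolding cinner_self of_real_eq_iff
  by simp

lemma norm_matrix_transpose: "norm (transpose A) = norm (A :: complex ^ 'n::finite ^ 'm::finite)"
proof -
  have "(norm (transpose A))\<^sup>2 = (norm A)\<^sup>2"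
    unfolding norm_matrix_sq by (subst sum.swap) (simp add: transpose_def)
  then show ?thesis by simp
qed

lemma norm_sq_rows: "(norm (A :: complex ^ 'n::finite ^ 'm::finite))\<^sup>2 = (\<Sum>i\<in>UNIV. (norm (A $ i))\<^sup>2)"
  by (simp add: norm_vec_def L2_set_def sum_nonneg)

lemma norm_sq_columns: "(norm (A :: complex ^ 'n::finite ^ 'm::finite))\<^sup>2 = (\<Sum>j\<in>UNIV. (norm (column j A))\<^sup>2)"
  using norm_sq_rows[of "transpose A"] unfolding norm_matrix_transpose
  by (simp add: column_def transpose_def)

lemma column_matrix_mult: "column j (A ** B) = A *v column j B"
  by (simp add: column_def matrix_matrix_mult_def matrix_vector_mult_def vec_eq_iff)

lemma matrix_vector_mult_axis: "A *v axis i 1 = column i (A :: complex ^ 'n::finite ^ 'm::finite)"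
  by (simp add: column_def matrix_vector_mult_def axis_def if_distrib[of "\<lambda>z. _ * z"] cong: if_cong)

lemma unitary_norm_mult_left:
  fixes A :: "complex ^ 'n::finite ^ 'n" and M :: "complex ^ 'm::finite ^ 'n"
  shows "unitary_matrix A \<Longrightarrow> norm (A ** M) = norm M"
proof -
  assume "unitary_matrix A"
  then have "(norm (A ** M))\<^sup>2 = (norm M)\<^sup>2"
    by (simp add: norm_sq_columns column_matrix_mult unitary_norm_mult_vec)
  then show ?thesis by simp
qed

lemma unitary_transpose: "unitary_matrix A \<Longrightarrow> unitary_matrix (transpose A)"
proof (rule unitary_matrixI)
  assume A: "unitary_matrix A"
  have "adjoint_matrix (transpose A) ** transpose A = transpose (A ** transpose (adjoint_matrix (transpose A)))"
    by (simp add: matrix_transpose_mul)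
  also have "transpose (adjoint_matrix (transpose A)) = adjoint_matrix A"
    by (simp add: adjoint_matrix_def transpose_def vec_eq_iff)
  finally show "adjoint_matrix (transpose A) ** transpose A = mat 1"
    using A by (simp add: unitary_matrix_def transpose_mat)
qed

lemma unitary_norm_mult_right:
  fixes A :: "complex ^ 'n::finite ^ 'n" and M :: "complex ^ 'n ^ 'm::finite"
  assumes "unitary_matrix A"
  shows "norm (M ** A) = norm M"
  by (metis assms matrix_transpose_mul norm_matrix_transpose unitary_norm_mult_left unitary_transpose)

section \<open>Householder reflections and QR factorisation\<close>

definition householder :: "complex ^ 'n::finite \<Rightarrow> complex ^ 'n ^ 'n" where
  "householder w = (\<chi> i j. (if i = j then 1 else 0) - 2 * w $ i * cnj (w $ j) / of_real ((norm w)\<^sup>2))"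

lemma householder_mult:
  "householder w *v x = x - (2 * cinner w x / of_real ((norm w)\<^sup>2)) *s w"
proof -
  have "(householder w *v x) $ i = x $ i - (2 * cinner w x / of_real ((norm w)\<^sup>2)) * w $ i" for i
  proof -
    have "(householder w *v x) $ i = (\<Sum>j\<in>UNIV. (if i = j then x $ j else 0)
      - (2 * w $ i / of_real ((norm w)\<^sup>2)) * (cnj (w $ j) * x $ j))"
      unfolding matrix_vector_mult_def householder_def
      by (auto intro!: sum.cong simp: algebra_simps)
    also have "\<dots> = x $ i - (2 * w $ i / of_real ((norm w)\<^sup>2)) * cinner w x"
      by (simp add: sum_subtractf cinner_def sum_distrib_left sum_divide_distrib)
    finally show ?thesis by (simp add: algebra_simps)
  qed
  then show ?thesis by (simp add: vec_eq_iff)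
qed

lemma adjoint_householder: "adjoint_matrix (householder w) = householder w"
  by (simp add: adjoint_matrix_def householder_def vec_eq_iff)

lemma unitary_householder: "unitary_matrix (householder w)"
proof (rule unitary_matrixI)
  have "householder w *v (householder w *v x) = x" for x
  \<comment> \<open>Division by zero yields 0, so for \<open>w = 0\<close> the reflection is the
    identity.\<close>
  proof (cases "w = 0")
    case False
    then have "cinner w w \<noteq> 0" by (simp add: cinner_self)
    then show ?thesis
      unfolding householder_mult cinner_self[symmetric]
      by (simp add: cinner_diff_right cinner_scale_right vec_eq_iff field_simps)
  qed (simp add: householder_mult)
  then show "adjoint_matrix (householder w) ** householder w = mat 1"
    by (simp add: adjoint_householder matrix_eq matrix_vector_mul_assoc[symmetric])
qed

text \<open>Equal norms alone do not suffice over the complex numbers. Reality of the inner product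
  gives \<open>cinner (x - y) (x - y) = 2 * cinner (x - y) x\<close>, so that the reflection
  subtracts \<open>x - y\<close> with coefficient exactly 1.\<close>

lemma householder_maps:
  assumes "norm x = norm y" and "cinner x y \<in> \<real>"
  shows "householder (x - y) *v x = y"
proof (cases "x = y")
  case True
  then show ?thesis by (simp add: householder_mult)
next
  case False
  have c: "cinner y x = cinner x y"
    using assms(2) cinner_commute[of x y] by (simp add: Reals_cnj_iff)
  have n: "cinner y y = cinner x x" by (simp add: cinner_self assms(1))
  have "cinner (x - y) (x - y) = 2 * cinner (x - y) x"
    by (simp add: cinner_diff_left cinner_diff_right c n)
  moreover have "cinner (x - y) (x - y) \<noteq> 0" using False by (simp add: cinner_self)
  ultimately show ?thesis
    unfolding householder_mult cinner_self[symmetric] by simp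
qed

text \<open>This localises the reflections: they leave finished rows and columns alone, and they
  respect blocks when \<open>w\<close> lives in one block.\<close>

lemma householder_outside: "w $ i = 0 \<or> w $ j = 0 \<Longrightarrow> householder w $ i $ j = (if i = j then 1 else 0)"
  by (auto simp: householder_def)

text \<open>QR factorisation: each step clears, by a reflection, the part of a column outside \<open>J\<close>.\<close>

lemma unitary_triangularize:
  fixes A :: "complex ^ 'n::finite ^ 'n" and p :: "'n \<Rightarrow> real"
  obtains k where "unitary_matrix k" "\<And>i j. (k ** A) $ i $ j \<noteq> 0 \<Longrightarrow> p j \<le> p i"
proof -
  have "\<exists>k. unitary_matrix k \<and> (\<forall>i j. p i < p j \<longrightarrow> (k ** A) $ i $ j = 0)"
  proof -
    \<comment> \<open>Induction on the number of columns still to be treated. \<open>J\<close> holds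
      indices with the largest values of \<open>p\<close>; its columns already vanish in rows
      outside \<open>J\<close> and in rows with a smaller value of \<open>p\<close>.\<close>
    have "\<exists>k. unitary_matrix k \<and> (\<forall>j\<in>J. \<forall>i. i \<notin> J \<or> p i < p j \<longrightarrow> (k ** A) $ i $ j = 0)
        \<Longrightarrow> (\<forall>i\<in>J. \<forall>j\<in>-J. p j \<le> p i) \<Longrightarrow> ?thesis" for J
    proof (induction "card (- J)" arbitrary: J)
      case 0
      then have "J = UNIV" by auto
      with 0 show ?case by auto
    next
      case (Suc n)
      obtain k where k: "unitary_matrix k"
        and z: "\<And>i j. j \<in> J \<Longrightarrow> i \<notin> J \<or> p i < p j \<Longrightarrow> (k ** A) $ i $ j = 0"
        using Suc.prems(1) by blast
      have "finite (p ` (- J))" "p ` (- J) \<noteq> {}" using Suc.hyps(2) by auto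
      then obtain m where m: "m \<notin> J" "\<And>j. j \<notin> J \<Longrightarrow> p j \<le> p m"
        using Max_in[of "p ` (- J)"] Max_ge[of "p ` (- J)"] by (metis ComplD ComplI image_iff)
      define v where "v = column m (k ** A)"
      define x where "x = (\<chi> i. if i \<in> J then 0 else v $ i)"
      \<comment> \<open>The phase of \<open>v $ m\<close> makes \<open>cinner x y\<close> real, as
        \<open>householder_maps\<close> requires; the value 1 in the degenerate case keeps
        \<open>cmod s = 1\<close>.\<close>
      define s where "s = (if v $ m = 0 then 1 else sgn (v $ m))"
      define y where "y = (s * of_real (norm x)) *s axis m 1"
      define H where "H = householder (x - y)"
      have s: "cmod s = 1" by (simp add: s_def norm_sgn)
      have ny: "norm y = norm x"
        using s by (simp add: y_def norm_vector_scale norm_axis_complex norm_mult)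
      have "cinner x y = cnj (v $ m) * s * of_real (norm x)"
        using m(1) by (simp add: y_def cinner_scale_right cinner_axis x_def)
      also have "cnj (v $ m) * s = of_real (cmod (v $ m))"
        by (simp add: s_def sgn_div_norm scaleR_conv_of_real field_simps complex_norm_square[symmetric] power2_eq_square
            flip: of_real_mult)
      finally have "cinner x y \<in> \<real>" by simp
      then have Hx: "H *v x = y" unfolding H_def using householder_maps ny by metis
      have wJ: "(x - y) $ i = 0" if "i \<in> J" for i
        using that m(1) by (auto simp: x_def y_def axis_def)
      have Hout: "H $ i $ j = (if i = j then 1 else 0)" if "i \<in> J \<or> j \<in> J" for i j
        unfolding H_def using that wJ by (intro householder_outside) auto
      have Hv: "(H *v v) $ i = y $ i" if "i \<notin> J" for i
      proof -
        have "(H *v v) $ i = (H *v x) $ i"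
          unfolding matrix_vector_mult_def using that by (auto intro!: sum.cong simp: x_def Hout)
        then show ?thesis by (simp add: Hx)
      qed
      have HB: "((H ** k) ** A) $ i $ j = (\<Sum>l\<in>UNIV. H $ i $ l * (k ** A) $ l $ j)" for i j
        by (simp only: matrix_mul_assoc[symmetric]) (simp add: matrix_matrix_mult_def)
      let ?J = "insert m J"
      have "((H ** k) ** A) $ i $ j = 0" if j: "j \<in> ?J" and i: "i \<notin> ?J \<or> p i < p j" for i j
      proof (cases "j \<in> J")
        case True
        \<comment> \<open>A finished column has no entries in rows outside \<open>J\<close>, and on
          \<open>J\<close> the reflection is the identity.\<close>
        have "H $ i $ l * (k ** A) $ l $ j = 0" for l
          using z[of j l] z[of j i] True i Hout[of i l] by (cases "l \<in> J") auto
        then show ?thesis unfolding HB by (intro sum.neutral ballI)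
      next
        case False
        with j have [simp]: "j = m" by simp
        have "i \<notin> J" using i Suc.prems(2) m(1) by (metis ComplI \<open>j = m\<close> insertCI not_le)
        moreover have "i \<noteq> m" using i by auto
        ultimately have "(H *v v) $ i = 0" using Hv[of i] by (simp add: y_def axis_def)
        then show ?thesis unfolding HB v_def matrix_vector_mult_def by (simp add: column_def)
      qed
      moreover have "unitary_matrix (H ** k)"
        unfolding H_def using unitary_mult unitary_householder k by blast
      moreover have "n = card (- ?J)"
      proof -
        have "- J = insert m (- ?J)" using m(1) by auto
        then have "card (- J) = Suc (card (- ?J))" by (metis ComplD card_insert_disjoint finite insertI1)
        then show ?thesis using Suc.hyps(2) by simp
      qed
      moreover have "\<forall>i\<in>?J. \<forall>j\<in>-?J. p j \<le> p i" using Suc.prems(2) m by auto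
      ultimately show ?case using Suc.hyps(1)[of ?J] by blast
    qed
    from this[of "{}"] show ?thesis using unitary_mat_1 by blast
  qed
  then show ?thesis using that by (meson not_le)
qed

section \<open>Block matrices and singular values\<close>

text \<open>Equivalently, \<open>A\<close> commutes with the diagonal matrix of \<open>p\<close>. In
  all three factors together this describes the centraliser of the point (p, q, r).\<close>

definition block_diagonal :: "('n \<Rightarrow> real) \<Rightarrow> complex ^ 'n::finite ^ 'n \<Rightarrow> bool" where
  "block_diagonal p A \<longleftrightarrow> (\<forall>i j. A $ i $ j \<noteq> 0 \<longrightarrow> p i = p j)"

definition block_part :: "('n \<Rightarrow> real) \<Rightarrow> complex ^ 'n::finite ^ 'n \<Rightarrow> complex ^ 'n ^ 'n" where
  "block_part p A = (\<chi> i j. if p i = p j then A $ i $ j else 0)"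

lemma block_diagonal_part: "block_diagonal p (block_part p A)"
  by (simp add: block_diagonal_def block_part_def)

lemma block_diagonal_mult:
  assumes "block_diagonal p A" "block_diagonal p B"
  shows "block_diagonal p (A ** B)"
  unfolding block_diagonal_def
proof (intro allI impI)
  fix i j assume "(A ** B) $ i $ j \<noteq> 0"
  then have "(\<Sum>k\<in>UNIV. A $ i $ k * B $ k $ j) \<noteq> 0" by (simp add: matrix_matrix_mult_def)
  then obtain k where "A $ i $ k * B $ k $ j \<noteq> 0" by (meson sum.neutral)
  then show "p i = p j" using assms unfolding block_diagonal_def by (metis mult_eq_0_iff)
qed

lemma block_diagonal_adjoint: "block_diagonal p A \<Longrightarrow> block_diagonal p (adjoint_matrix A)"
  by (auto simp: block_diagonal_def adjoint_matrix_def)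

lemma block_diagonal_diag: "block_diagonal p (diag_matrix d)"
  by (auto simp: block_diagonal_def diag_matrix_def)

lemma diag_matrix_mult: "diag_matrix d ** diag_matrix e = diag_matrix (\<lambda>i. d i * (e i :: 'a::semiring_1))"
  by (simp add: diag_matrix_def matrix_matrix_mult_def vec_eq_iff if_distrib[of "\<lambda>z. _ * z"]
      if_distrib[of "\<lambda>z. z * _"] cong: if_cong)

lemma diag_matrix_one: "diag_matrix (\<lambda>i. 1) = mat 1"
  by (simp add: diag_matrix_def mat_def)

lemma invertible_diag_matrix:
  fixes d :: "'n::finite \<Rightarrow> 'a::field"
  assumes "\<And>i. d i \<noteq> 0"
  shows "invertible (diag_matrix d)"
  unfolding invertible_def
  by (rule exI[of _ "diag_matrix (\<lambda>i. inverse (d i))"]) (simp add: diag_matrix_mult assms diag_matrix_one)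

text \<open>In the Leibniz formula only permutations preserving \<open>p\<close> contribute, since the others
  would have to increase the sum of the values of \<open>p\<close>.\<close>

lemma det_block_part:
  assumes tri: "\<And>i j. A $ i $ j \<noteq> 0 \<Longrightarrow> p j \<le> p i"
  shows "det (block_part p A) = det A"
  unfolding det_def
proof (rule sum.cong[OF refl])
  fix \<sigma> :: "'a \<Rightarrow> 'a" assume "\<sigma> \<in> {\<sigma>. \<sigma> permutes UNIV}"
  then have perm: "\<sigma> permutes UNIV" by simp
  have "(\<Prod>i\<in>UNIV. block_part p A $ i $ \<sigma> i) = (\<Prod>i\<in>UNIV. A $ i $ \<sigma> i)"
  proof (cases "\<forall>i. p i = p (\<sigma> i)")
    case True
    then show ?thesis by (simp add: block_part_def)
  next
    case False
    then obtain i where i: "p i \<noteq> p (\<sigma> i)" by blast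
    have "\<exists>j. A $ j $ \<sigma> j = 0"
    proof (rule ccontr)
      assume "\<not> ?thesis"
      then have le: "p (\<sigma> j) \<le> p j" for j using tri by blast
      then have "(\<Sum>j\<in>UNIV. p (\<sigma> j)) < (\<Sum>j\<in>UNIV. p j)"
        using i by (intro sum_strict_mono_ex1) (auto intro!: exI[of _ i] simp: order.strict_iff_order)
      moreover have "(\<Sum>j\<in>UNIV. p (\<sigma> j)) = (\<Sum>j\<in>UNIV. p j)"
        using sum.permute[OF perm, of p] by (simp add: o_def)
      ultimately show False by simp
    qed
    moreover have "\<exists>j. block_part p A $ j $ \<sigma> j = 0" using i by (auto simp: block_part_def)
    ultimately show ?thesis by (metis (no_types, lifting) UNIV_I finite prod_zero)
  qed
  then show "of_int (sign \<sigma>) * (\<Prod>i\<in>UNIV. block_part p A $ i $ \<sigma> i)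
    = of_int (sign \<sigma>) * (\<Prod>i\<in>UNIV. A $ i $ \<sigma> i)" by simp
qed

text \<open>Passage from the parabolic subgroup of \<open>p\<close> to its Levi factor; the
  determinant does not change.\<close>

lemma invertible_block_part:
  assumes "\<And>i j. A $ i $ j \<noteq> 0 \<Longrightarrow> p j \<le> p i" and "invertible A"
  shows "invertible (block_part p A)"
  using assms det_block_part[of A p] by (simp add: invertible_det_nz)

lemma norm_unitary:
  fixes A :: "complex ^ 'n::finite ^ 'n"
  assumes "unitary_matrix A"
  shows "norm A = norm (mat 1 :: complex ^ 'n ^ 'n)"
  using unitary_norm_mult_left[OF assms, of "mat 1"] by simp

text \<open>With a constant \<open>p\<close> this is the full unitary group. Compactness supplies a
  maximiser in the Jacobi argument and convergent subsequences of unitaries later.\<close>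

lemma compact_block_unitary:
  "compact {A :: complex ^ 'n::finite ^ 'n. unitary_matrix A \<and> block_diagonal p A}" (is "compact ?K")
proof -
  have "?K = {A. adjoint_matrix A ** A = mat 1} \<inter> (\<Inter>i. \<Inter>j. {A. p i = p j \<or> A $ i $ j = 0})"
    by (auto simp: block_diagonal_def unitary_matrixI) (auto simp: unitary_matrix_def)
  moreover have "closed {A :: complex ^ 'n ^ 'n. adjoint_matrix A ** A = mat 1}"
    unfolding adjoint_matrix_def matrix_matrix_mult_def
    by (intro closed_Collect_eq continuous_intros)
  moreover have "closed {A :: complex ^ 'n ^ 'n. p i = p j \<or> A $ i $ j = 0}" for i j
    by (cases "p i = p j") (auto intro!: closed_Collect_eq continuous_intros)
  ultimately have "closed ?K" by (simp add: closed_INT closed_Int)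
  moreover have "bounded ?K"
    unfolding bounded_iff by (rule exI[of _ "norm (mat 1 :: complex ^ 'n ^ 'n)"]) (auto simp: norm_unitary)
  ultimately show ?thesis by (simp add: compact_eq_bounded_closed)
qed

text \<open>One-sided Jacobi: a unitary maximising the sum of the fourth powers of the column norms
  makes the columns orthogonal, as otherwise a reflection in two columns would increase it.\<close>

lemma orthogonal_columns:
  fixes h :: "complex ^ 'n::finite ^ 'n"
  assumes "block_diagonal p h"
  obtains r where "unitary_matrix r" "block_diagonal p r"
    "\<And>i j. i \<noteq> j \<Longrightarrow> cinner (column i (h ** r)) (column j (h ** r)) = 0"
proof -
  let ?K = "{A :: complex ^ 'n ^ 'n. unitary_matrix A \<and> block_diagonal p A}"
  define f where "f (r :: complex ^ 'n ^ 'n) = (\<Sum>l\<in>UNIV. ((norm (column l (h ** r)))\<^sup>2)\<^sup>2)" for r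
  have "continuous_on ?K f"
    unfolding f_def column_matrix_mult
    unfolding column_def matrix_vector_mult_def by (intro continuous_intros)
  moreover have "mat 1 \<in> ?K" using unitary_mat_1 block_diagonal_diag[of p "\<lambda>i. 1"] by (simp add: diag_matrix_one)
  ultimately obtain r where r: "unitary_matrix r" "block_diagonal p r"
    and max: "\<And>s. unitary_matrix s \<Longrightarrow> block_diagonal p s \<Longrightarrow> f s \<le> f r"
    using continuous_attains_sup[OF compact_block_unitary, of p f] by (auto simp: ex_in_conv[symmetric])
  define B where "B = h ** r"
  have Bb: "block_diagonal p B" unfolding B_def using assms r by (intro block_diagonal_mult)
  \<comment> \<open>By symmetry only pairs whose first column is at least as long need
    treatment.\<close>
  have *: "cinner (column i B) (column j B) = 0"
    if ij: "i \<noteq> j" and le: "norm (column j B) \<le> norm (column i B)" for i j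
  proof (rule ccontr)
    let ?u = "column i B" and ?v = "column j B"
    assume nz: "cinner ?u ?v \<noteq> 0"
    then have u0: "?u \<noteq> 0" by (auto simp: cinner_def)
    \<comment> \<open>Columns from different blocks have disjoint supports. Hence a reflection
      mixing \<open>i\<close> and \<open>j\<close> stays block diagonal.\<close>
    have pij: "p i = p j"
    proof -
      obtain l where "cnj (?u $ l) * ?v $ l \<noteq> 0" using nz unfolding cinner_def by (meson sum.neutral)
      then have "B $ l $ i \<noteq> 0" "B $ l $ j \<noteq> 0" by (auto simp: column_def)
      then show ?thesis using Bb unfolding block_diagonal_def by metis
    qed
    \<comment> \<open>The new column is u + b v, divided by the length \<open>R\<close> of the
      coefficient vector (1, b). The phase of \<open>b\<close> makes the cross term t =
      \<open>b * cinner ?u ?v\<close> positive, and its size gives |b|^2 |u|^2 = t. So the gain 2 t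
      exceeds the loss t from the normalisation, and the column becomes longer than u.\<close>
    define b where "b = cnj (cinner ?u ?v) / of_real ((norm ?u)\<^sup>2)"
    define R where "R = sqrt (1 + (cmod b)\<^sup>2)"
    have R: "R > 0" "R\<^sup>2 = 1 + (cmod b)\<^sup>2" unfolding R_def by (auto simp: add_pos_nonneg)
    define y where "y = (1 / of_real R :: complex) *s (axis i 1 + b *s axis j 1)"
    define w where "w = axis i 1 - y"
    define H where "H = householder w"
    have ny: "norm y = 1"
    proof -
      have "cinner (axis i 1 + b *s axis j 1) (axis i 1 + b *s axis j 1) = 1 + cnj b * b"
        using ij by (simp add: cinner_add_left cinner_add_right cinner_scale_left cinner_scale_right cinner_axis)
          (simp add: axis_def)
      also have "\<dots> = of_real (R\<^sup>2)"
        by (simp add: R(2) mult.commute complex_norm_square del: of_real_power)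
      finally have "norm (axis i 1 + b *s axis j 1 :: complex ^ 'n) = R"
        using R(1) unfolding cinner_self of_real_eq_iff by simp
      then show ?thesis unfolding y_def norm_vector_scale using R(1) by (simp add: norm_divide)
    qed
    have "cinner (axis i 1) y = of_real (1 / R)"
      using ij unfolding y_def cinner_scale_right cinner_add_right cinner_axis by (simp add: axis_def)
    then have He: "H *v axis i 1 = y"
      unfolding H_def w_def by (intro householder_maps) (simp_all add: ny norm_axis_complex)
    have w0: "w $ l = 0" if "l \<noteq> i" "l \<noteq> j" for l
      using that by (simp add: w_def y_def axis_def)
    have Hb: "block_diagonal p H"
      unfolding block_diagonal_def
    proof (intro allI impI)
      fix k l assume "H $ k $ l \<noteq> 0"
      then have "k = l \<or> (w $ k \<noteq> 0 \<and> w $ l \<noteq> 0)"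
        unfolding H_def using householder_outside[of w k l] by auto
      then show "p k = p l" using w0 pij by metis
    qed
    have Hu: "unitary_matrix H" unfolding H_def by (rule unitary_householder)
    define B' where "B' = B ** H"
    have col: "column l B' = B *v column l H" for l unfolding B'_def by (rule column_matrix_mult)
    have c1: "column l B' = column l B" if "l \<noteq> i" "l \<noteq> j" for l
    proof -
      have "B' $ k $ l = B $ k $ l" for k
        unfolding B'_def matrix_matrix_mult_def H_def using w0[OF that]
        by (simp add: householder_outside if_distrib[of "\<lambda>z. _ * z"] cong: if_cong)
      then show ?thesis by (simp add: column_def)
    qed
    have "column i B' = B *v y"
      unfolding col He[symmetric] by (simp add: matrix_vector_mult_axis)
    also have "\<dots> = (1 / of_real R) *s (?u + b *s ?v)"
      unfolding y_def by (simp add: matrix_vector_right_distrib matrix_vector_mult_axis vector_scalar_commute)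
    finally have ci: "column i B' = (1 / of_real R) *s (?u + b *s ?v)" .
    have big: "(norm (column i B'))\<^sup>2 > (norm ?u)\<^sup>2"
    proof -
      define t where "t = (cmod (cinner ?u ?v))\<^sup>2 / (norm ?u)\<^sup>2"
      have t: "t > 0" unfolding t_def using nz u0 by simp
      have "cmod b = cmod (cinner ?u ?v) / (norm ?u)\<^sup>2" by (simp add: b_def norm_divide norm_power)
      then have b2: "(cmod b)\<^sup>2 * (norm ?u)\<^sup>2 = t"
        using u0 by (simp add: t_def power_divide field_simps power2_eq_square)
      have bc: "b * cinner ?u ?v = of_real t"
        unfolding b_def t_def of_real_divide complex_norm_square by (simp add: mult.commute)
      have "cinner (?u + b *s ?v) (?u + b *s ?v) = cinner ?u ?u + b * cinner ?u ?v + cnj (b * cinner ?u ?v) + cnj b * b * cinner ?v ?v"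
        by (simp add: cinner_add_left cinner_add_right cinner_scale_left cinner_scale_right algebra_simps
            cinner_commute[of ?v ?u])
      also have "\<dots> = of_real ((norm ?u)\<^sup>2 + 2 * t + (cmod b)\<^sup>2 * (norm ?v)\<^sup>2)"
        unfolding bc cinner_self by (simp add: complex_norm_square mult.commute del: of_real_power)
      finally have "(norm (?u + b *s ?v))\<^sup>2 = (norm ?u)\<^sup>2 + 2 * t + (cmod b)\<^sup>2 * (norm ?v)\<^sup>2"
        unfolding cinner_self of_real_eq_iff .
      also have "\<dots> > R\<^sup>2 * (norm ?u)\<^sup>2"
        unfolding R(2) using t b2 by (simp add: algebra_simps add_pos_nonneg)
      finally have "R\<^sup>2 * (norm ?u)\<^sup>2 < (norm (?u + b *s ?v))\<^sup>2" .
      then show ?thesis unfolding ci norm_vector_scale using R(1)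
        by (simp add: norm_divide power_divide power_mult_distrib field_simps)
    qed
    have split: "(\<Sum>l\<in>UNIV. g l) = g i + g j + (\<Sum>l\<in>UNIV - {i,j}. g l)" for g :: "'n \<Rightarrow> real"
      using ij sum.subset_diff[of "{i,j}" UNIV g] by simp
    have "norm B' = norm B" unfolding B'_def using Hu by (rule unitary_norm_mult_right)
    then have "(\<Sum>l\<in>UNIV. (norm (column l B'))\<^sup>2) = (\<Sum>l\<in>UNIV. (norm (column l B))\<^sup>2)"
      by (metis norm_sq_columns)
    then have sum: "(norm (column i B'))\<^sup>2 + (norm (column j B'))\<^sup>2 = (norm ?u)\<^sup>2 + (norm ?v)\<^sup>2"
      unfolding split by (simp add: c1)
    have "f (r ** H) \<le> f r"
      using r Hb Hu by (intro max unitary_mult block_diagonal_mult)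
    then have "((norm (column i B'))\<^sup>2)\<^sup>2 + ((norm (column j B'))\<^sup>2)\<^sup>2 \<le> ((norm ?u)\<^sup>2)\<^sup>2 + ((norm ?v)\<^sup>2)\<^sup>2"
      unfolding f_def matrix_mul_assoc B_def[symmetric] B'_def[symmetric] split by (simp add: c1)
    \<comment> \<open>Strict convexity: with a fixed sum, making the larger of two numbers larger
      increases the sum of squares.\<close>
    moreover have "\<And>x y a b :: real. x\<^sup>2 + y\<^sup>2 \<le> a\<^sup>2 + b\<^sup>2 \<Longrightarrow> x + y = a + b \<Longrightarrow> b \<le> a \<Longrightarrow> x > a \<Longrightarrow> False"
    proof -
      fix x y a b :: real
      assume *: "x\<^sup>2 + y\<^sup>2 \<le> a\<^sup>2 + b\<^sup>2" "x + y = a + b" "b \<le> a" "x > a"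
      then have y: "y = a + b - x" by simp
      have "x\<^sup>2 + y\<^sup>2 - (a\<^sup>2 + b\<^sup>2) = 2 * ((x - a) * (x - b))"
        unfolding y by (simp add: power2_eq_square algebra_simps)
      moreover have "(x - a) * (x - b) > 0" using * by (intro mult_pos_pos) auto
      ultimately show False using *(1) by simp
    qed
    moreover have "(norm ?v)\<^sup>2 \<le> (norm ?u)\<^sup>2" using le by simp
    ultimately show False using sum big by blast
  qed
  have "cinner (column i B) (column j B) = 0" if "i \<noteq> j" for i j
    using *[of i j] *[of j i] that cinner_commute[of "column i B" "column j B"] by (metis complex_cnj_zero linear)
  then show ?thesis using that r unfolding B_def by blast
qed

text \<open>Once the columns of \<open>h ** r\<close> are orthogonal, dividing them by their norms
  \<open>d\<close> gives a unitary matrix, whose adjoint is \<open>q\<close>; the \<open>r\<close>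
  of the conclusion is the adjoint of that first one. Every step preserves blocks, so the
  decomposition takes place inside the centraliser of \<open>p\<close>.\<close>

lemma singular_value_decomposition:
  fixes h :: "complex ^ 'n::finite ^ 'n"
  assumes b: "block_diagonal p h" and inv: "invertible h"
  obtains q r and d :: "'n \<Rightarrow> real" where "unitary_matrix q" "block_diagonal p q"
    "unitary_matrix r" "block_diagonal p r" "\<And>i. d i > 0"
    "q ** h = diag_matrix (\<lambda>i. of_real (d i)) ** r"
proof -
  obtain r where r: "unitary_matrix r" "block_diagonal p r"
    and orth: "\<And>i j. i \<noteq> j \<Longrightarrow> cinner (column i (h ** r)) (column j (h ** r)) = 0"
    by (rule orthogonal_columns[OF b]) blast
  define B where "B = h ** r"
  have "invertible r" using r(1) unfolding invertible_def unitary_matrix_def by blast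
  then have Binv: "invertible B" unfolding B_def using inv invertible_mult by blast
  define d where "d i = norm (column i B)" for i
  have d: "d i > 0" for i
  proof (rule ccontr)
    assume "\<not> ?thesis"
    then have "B *v axis i 1 = 0" by (simp add: d_def matrix_vector_mult_axis)
    moreover obtain C where "C ** B = mat 1" using Binv unfolding invertible_def by blast
    ultimately have "axis i (1::complex) = 0"
      by (metis matrix_vector_mul_assoc matrix_vector_mul_lid matrix_vector_mult_0_right)
    then show False by (simp add: axis_eq_0_iff)
  qed
  define D where "D = diag_matrix (\<lambda>i. complex_of_real (d i))"
  define E where "E = diag_matrix (\<lambda>i. complex_of_real (1 / d i))"
  have DE: "E ** D = mat 1" "D ** E = mat 1"
    unfolding D_def E_def diag_matrix_mult using d by (simp_all add: diag_matrix_one less_imp_neq[symmetric] flip: of_real_mult)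
  have adjE: "adjoint_matrix E = E"
    by (auto simp: E_def diag_matrix_def adjoint_matrix_def vec_eq_iff)
  have BB: "adjoint_matrix B ** B = D ** D"
  proof -
    have "(adjoint_matrix B ** B) $ i $ j = cinner (column i B) (column j B)" for i j
      by (simp add: adjoint_matrix_def matrix_matrix_mult_def cinner_def column_def)
    then show ?thesis
      using orth unfolding D_def diag_matrix_mult B_def[symmetric]
      by (auto simp: vec_eq_iff diag_matrix_def cinner_self d_def power2_eq_square)
  qed
  define q where "q = adjoint_matrix (B ** E)"
  have u: "unitary_matrix (B ** E)"
  proof (rule unitary_matrixI)
    have "adjoint_matrix (B ** E) ** (B ** E) = E ** (adjoint_matrix B ** B) ** E"
      by (simp add: adjoint_matrix_mult adjE matrix_mul_assoc)
    also have "\<dots> = (E ** D) ** (D ** E)" unfolding BB by (simp add: matrix_mul_assoc)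
    finally show "adjoint_matrix (B ** E) ** (B ** E) = mat 1" by (simp add: DE)
  qed
  have "h = B ** adjoint_matrix r"
    unfolding B_def matrix_mul_assoc[symmetric] using r(1) by (simp add: unitary_matrix_def)
  then have "q ** h = E ** (adjoint_matrix B ** B) ** adjoint_matrix r"
    by (simp add: q_def adjoint_matrix_mult adjE matrix_mul_assoc)
  also have "\<dots> = (E ** D) ** D ** adjoint_matrix r" unfolding BB by (simp add: matrix_mul_assoc)
  finally have "q ** h = D ** adjoint_matrix r" by (simp add: DE)
  moreover have "block_diagonal p q"
    unfolding q_def B_def E_def
    using b r by (intro block_diagonal_adjoint block_diagonal_mult block_diagonal_diag)
  ultimately show ?thesis
    using that[of q "adjoint_matrix r" d] u r d
    by (auto simp: q_def unitary_adjoint block_diagonal_adjoint D_def)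
qed

section \<open>Moments of torus orbits\<close>

text \<open>If \<open>p\<close> is on the relative boundary of the hull, the infimum of
  \<open>E\<close> need not be attained. Therefore the summands are followed along a minimising
  sequence, and stationarity is tested on their limits \<open>z\<close> instead of at a
  minimiser.\<close>

lemma exp_weight_minimizer:
  fixes w :: "'i \<Rightarrow> 'v::euclidean_space" and y :: "'i \<Rightarrow> real"
  assumes fin: "finite \<Omega>" "\<Omega> \<noteq> {}" and y: "\<And>\<omega>. \<omega> \<in> \<Omega> \<Longrightarrow> y \<omega> > 0"
    and p: "p \<in> convex hull (w ` \<Omega>)"
  obtains c :: real and h z where "c > 0"
    "\<And>\<omega>. \<omega> \<in> \<Omega> \<Longrightarrow> (\<lambda>n::nat. c * y \<omega> * exp (h n \<bullet> (w \<omega> - p))) \<longlonglongrightarrow> z \<omega>"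
    "\<And>\<omega>. \<omega> \<in> \<Omega> \<Longrightarrow> z \<omega> \<ge> 0" "(\<Sum>\<omega>\<in>\<Omega>. z \<omega>) = 1" "(\<Sum>\<omega>\<in>\<Omega>. z \<omega> *\<^sub>R w \<omega>) = p"
proof -
  define E where "E h = (\<Sum>\<omega>\<in>\<Omega>. y \<omega> * exp (h \<bullet> (w \<omega> - p)))" for h
  define y0 where "y0 = Min (y ` \<Omega>)"
  have y0: "y0 > 0" "\<And>\<omega>. \<omega> \<in> \<Omega> \<Longrightarrow> y0 \<le> y \<omega>" unfolding y0_def using fin y by auto
  have E_ge: "E h \<ge> y0" for h
  proof -
    \<comment> \<open>As \<open>p\<close> is in the hull, the weights cannot all lie strictly on one
      side of a hyperplane through \<open>p\<close>. One nonnegative exponent already bounds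
      \<open>E\<close> below by a positive constant.\<close>
    have "\<exists>\<omega>\<in>\<Omega>. h \<bullet> (w \<omega> - p) \<ge> 0"
    proof (rule ccontr)
      assume "\<not> ?thesis"
      then have "w ` \<Omega> \<subseteq> {x. h \<bullet> x < h \<bullet> p}" by (auto simp: inner_diff_right)
      then have "convex hull (w ` \<Omega>) \<subseteq> {x. h \<bullet> x < h \<bullet> p}"
        by (rule hull_minimal) (rule convex_halfspace_lt)
      with p show False by auto
    qed
    then obtain \<omega> where \<omega>: "\<omega> \<in> \<Omega>" "h \<bullet> (w \<omega> - p) \<ge> 0" by blast
    have "y0 \<le> y \<omega> * 1" using y0 \<omega> by simp
    also have "\<dots> \<le> y \<omega> * exp (h \<bullet> (w \<omega> - p))"
      using \<omega> y by (intro mult_left_mono) (auto intro: less_imp_le)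
    also have "\<dots> \<le> E h"
      unfolding E_def using \<omega> fin y
      by (intro member_le_sum[of \<omega> \<Omega> "\<lambda>\<omega>. y \<omega> * exp (h \<bullet> (w \<omega> - p))"]) (auto intro: less_imp_le)
    finally show ?thesis .
  qed
  define m where "m = (INF h. E h)"
  have bdd: "bdd_below (range E)" using E_ge by (intro bdd_belowI[of _ y0]) auto
  have m_le: "m \<le> E h" for h unfolding m_def using bdd by (intro cINF_lower) auto
  have m: "m \<ge> y0" unfolding m_def using E_ge by (intro cINF_greatest) auto
  have "\<exists>h. E h < m + 1 / real (Suc n)" for n
    using cINF_less_iff[OF _ bdd, of "m + 1 / real (Suc n)"] by (simp add: m_def)
  then obtain g where g: "\<And>n. E (g n) < m + 1 / real (Suc n)" by metis
  have lim1: "(\<lambda>n. E (g n)) \<longlonglongrightarrow> m"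
  proof (rule tendsto_sandwich[of "\<lambda>n. m" _ _ "\<lambda>n. m + 1 / real (Suc n)"])
    show "(\<lambda>n. m + 1 / real (Suc n)) \<longlonglongrightarrow> m"
      using tendsto_add[OF tendsto_const LIMSEQ_inverse_real_of_nat, of m] by (simp add: inverse_eq_divide)
  qed (use m_le g in \<open>auto intro!: always_eventually less_imp_le\<close>)
  define Z where "Z n \<omega> = y \<omega> * exp (g n \<bullet> (w \<omega> - p))" for n \<omega>
  have Z0: "Z n \<omega> \<ge> 0" if "\<omega> \<in> \<Omega>" for n \<omega> unfolding Z_def using y that by (simp add: less_imp_le)
  have ZE: "(\<Sum>\<omega>\<in>\<Omega>. Z n \<omega>) = E (g n)" for n by (simp add: Z_def E_def)
  have Zle: "Z n \<omega> \<le> m + 1" if "\<omega> \<in> \<Omega>" for n \<omega>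
  proof -
    have "Z n \<omega> \<le> E (g n)" unfolding ZE[symmetric] using fin Z0 that by (intro member_le_sum) auto
    also have "\<dots> \<le> m + 1 / real (Suc n)" using g[of n] by simp
    also have "\<dots> \<le> m + 1" by simp
    finally show ?thesis .
  qed
  \<comment> \<open>The summands lie in the compact interval from 0 to m + 1; adding one index at a
    time makes all of them converge along a common subsequence.\<close>
  have "\<exists>r z. strict_mono (r :: nat \<Rightarrow> nat) \<and> (\<forall>\<omega>\<in>A. (\<lambda>n. Z (r n) \<omega>) \<longlonglongrightarrow> z \<omega>)"
    if "finite A" "A \<subseteq> \<Omega>" for A
    using that
  proof (induction A rule: finite_induct)
    case empty
    show ?case by (auto intro: exI[of _ id] strict_mono_id)
  next
    case (insert \<omega> A)
    then obtain r z where r: "strict_mono (r :: nat \<Rightarrow> nat)" "\<And>\<omega>. \<omega> \<in> A \<Longrightarrow> (\<lambda>n. Z (r n) \<omega>) \<longlonglongrightarrow> z \<omega>"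
      by auto
    have "\<forall>n. Z (r n) \<omega> \<in> {0..m+1}" using Z0 Zle insert.prems by auto
    then obtain l q where q: "strict_mono (q :: nat \<Rightarrow> nat)" "((\<lambda>n. Z (r n) \<omega>) \<circ> q) \<longlonglongrightarrow> l"
      using compact_Icc[of 0 "m+1", unfolded compact_def, rule_format, of "\<lambda>n. Z (r n) \<omega>"] by blast
    have "(\<lambda>n. Z ((r \<circ> q) n) \<omega>') \<longlonglongrightarrow> (z(\<omega> := l)) \<omega>'" if "\<omega>' \<in> insert \<omega> A" for \<omega>'
      using that q insert.hyps LIMSEQ_subseq_LIMSEQ[OF r(2)[of \<omega>'] q(1)] by (auto simp: o_def)
    then show ?case using strict_mono_o[OF r(1) q(1)] by blast
  qed
  from this[of \<Omega>] fin obtain r z where r: "strict_mono (r :: nat \<Rightarrow> nat)"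
    and z: "\<And>\<omega>. \<omega> \<in> \<Omega> \<Longrightarrow> (\<lambda>n. Z (r n) \<omega>) \<longlonglongrightarrow> z \<omega>" by auto
  have z0: "z \<omega> \<ge> 0" if "\<omega> \<in> \<Omega>" for \<omega> using z that Z0 by (intro LIMSEQ_le_const[OF z]) auto
  have "(\<lambda>n. \<Sum>\<omega>\<in>\<Omega>. Z (r n) \<omega>) \<longlonglongrightarrow> (\<Sum>\<omega>\<in>\<Omega>. z \<omega>)" using z by (rule tendsto_sum)
  moreover have "(\<lambda>n. \<Sum>\<omega>\<in>\<Omega>. Z (r n) \<omega>) \<longlonglongrightarrow> m"
    unfolding ZE using LIMSEQ_subseq_LIMSEQ[OF lim1 r] by (simp add: o_def)
  ultimately have zm: "(\<Sum>\<omega>\<in>\<Omega>. z \<omega>) = m" by (rule LIMSEQ_unique)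
  \<comment> \<open>\<open>d\<close> is the gradient in the limit. Translating the minimising
    sequence by \<open>e *\<^sub>R d\<close> turns the limit of \<open>E\<close> into
    \<open>F e\<close>, which is at least m = F 0; since the derivative of \<open>F\<close> at 0 is
    \<open>d \<bullet> d\<close>, it follows that \<open>d = 0\<close>.\<close>
  define d where "d = (\<Sum>\<omega>\<in>\<Omega>. z \<omega> *\<^sub>R (w \<omega> - p))"
  define F where "F e = (\<Sum>\<omega>\<in>\<Omega>. z \<omega> * exp (e * (d \<bullet> (w \<omega> - p))))" for e :: real
  have F_ge: "F e \<ge> m" for e
  proof -
    have "(\<lambda>n. \<Sum>\<omega>\<in>\<Omega>. Z (r n) \<omega> * exp (e * (d \<bullet> (w \<omega> - p)))) \<longlonglongrightarrow> F e"
      unfolding F_def using z by (intro tendsto_sum tendsto_mult_right)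
    moreover have "(\<Sum>\<omega>\<in>\<Omega>. Z (r n) \<omega> * exp (e * (d \<bullet> (w \<omega> - p)))) = E (g (r n) + e *\<^sub>R d)" for n
      by (simp add: Z_def E_def inner_add_left exp_add mult.assoc)
    ultimately show ?thesis using m_le by (intro LIMSEQ_le_const[of _ "F e" m]) auto
  qed
  have "(F has_real_derivative (\<Sum>\<omega>\<in>\<Omega>. z \<omega> * (d \<bullet> (w \<omega> - p)))) (at 0)"
    unfolding F_def by (auto intro!: derivative_eq_intros sum.cong)
  moreover have "(\<Sum>\<omega>\<in>\<Omega>. z \<omega> * (d \<bullet> (w \<omega> - p))) = d \<bullet> d"
    unfolding d_def inner_sum_right inner_scaleR_right ..
  ultimately have "(F has_real_derivative d \<bullet> d) (at 0)" by simp
  moreover have "F 0 = m" by (simp add: F_def zm)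
  ultimately have "d \<bullet> d = 0"
    using DERIV_local_min[of F "d \<bullet> d" 0 1] F_ge by auto
  then have "d = 0" by simp
  then have zp: "(\<Sum>\<omega>\<in>\<Omega>. z \<omega> *\<^sub>R w \<omega>) = m *\<^sub>R p"
    unfolding d_def by (simp add: scaleR_diff_right sum_subtractf zm flip: scaleR_sum_left)
  have mpos: "m > 0" using m y0 by simp
  show ?thesis
  \<comment> \<open>The limits add up to m > 0, so division by m makes them probability
    weights.\<close>
  proof (rule that[of "1 / m" "\<lambda>n. g (r n)" "\<lambda>\<omega>. z \<omega> / m"])
    show "(\<lambda>n. 1 / m * y \<omega> * exp (g (r n) \<bullet> (w \<omega> - p))) \<longlonglongrightarrow> z \<omega> / m" if "\<omega> \<in> \<Omega>" for \<omega>
      using tendsto_divide[OF z[OF that] tendsto_const[of m]] mpos by (simp add: Z_def)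
    show "(\<Sum>\<omega>\<in>\<Omega>. (z \<omega> / m) *\<^sub>R w \<omega>) = p"
      using arg_cong[OF zp, of "\<lambda>x. (1 / m) *\<^sub>R x"] mpos
      by (simp add: scaleR_sum_right)
    show "(\<Sum>\<omega>\<in>\<Omega>. z \<omega> / m) = 1" using zm mpos by (simp flip: sum_divide_distrib)
  qed (use mpos z0 in auto)
qed

section \<open>The action and the moment map\<close>

lemma sum_triple:
  "(\<Sum>i\<in>UNIV. \<Sum>j\<in>UNIV. \<Sum>k\<in>UNIV. f i j k) =
    (\<Sum>(i,j,k)\<in>(UNIV :: ('a::finite \<times> 'b::finite \<times> 'c::finite) set). f i j k)"
  by (simp add: sum.cartesian_product flip: UNIV_Times_UNIV)

lemma sum_double:
  "(\<Sum>i\<in>UNIV. \<Sum>j\<in>UNIV. f i j) = (\<Sum>(i,j)\<in>(UNIV :: ('a::finite \<times> 'b::finite) set). f i j)"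
  by (simp add: sum.cartesian_product flip: UNIV_Times_UNIV)

lemma act_nth: "((A, B, C) \<bullet>\<^sub>t T) $ i $ j $ k =
  (\<Sum>i'\<in>UNIV. \<Sum>j'\<in>UNIV. \<Sum>k'\<in>UNIV. A $ i $ i' * B $ j $ j' * C $ k $ k' * T $ i' $ j' $ k')"
  by (simp add: act_def)

lemma act_act:
  fixes T :: "('a::finite, 'b::finite, 'c::finite) tensor3"
  shows "(A, B, C) \<bullet>\<^sub>t ((A', B', C') \<bullet>\<^sub>t T) = (A ** A', B ** B', C ** C') \<bullet>\<^sub>t T"
proof -
  have "((A, B, C) \<bullet>\<^sub>t ((A', B', C') \<bullet>\<^sub>t T)) $ i $ j $ k = ((A ** A', B ** B', C ** C') \<bullet>\<^sub>t T) $ i $ j $ k" for i j k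
  proof -
    have "((A, B, C) \<bullet>\<^sub>t ((A', B', C') \<bullet>\<^sub>t T)) $ i $ j $ k =
      (\<Sum>x\<in>UNIV. \<Sum>y\<in>UNIV. case x of (i',j',k') \<Rightarrow> case y of (i'',j'',k'') \<Rightarrow>
        A $ i $ i' * B $ j $ j' * C $ k $ k' * (A' $ i' $ i'' * B' $ j' $ j'' * C' $ k' $ k'' * T $ i'' $ j'' $ k''))"
      unfolding act_nth sum_triple by (auto intro!: sum.cong simp: sum_distrib_left split: prod.splits)
    also have "\<dots> = (\<Sum>y\<in>UNIV. \<Sum>x\<in>UNIV. case x of (i',j',k') \<Rightarrow> case y of (i'',j'',k'') \<Rightarrow>
        A $ i $ i' * B $ j $ j' * C $ k $ k' * (A' $ i' $ i'' * B' $ j' $ j'' * C' $ k' $ k'' * T $ i'' $ j'' $ k''))"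
      by (rule sum.swap)
    also have "\<dots> = ((A ** A', B ** B', C ** C') \<bullet>\<^sub>t T) $ i $ j $ k"
      unfolding act_nth sum_triple[of "\<lambda>i' j' k'. (A ** A') $ i $ i' * (B ** B') $ j $ j' * (C ** C') $ k $ k' * T $ i' $ j' $ k'"]
    proof (intro sum.cong refl)
      fix y :: "'a \<times> 'b \<times> 'c"
      obtain i'' j'' k'' where y: "y = (i'', j'', k'')" by (rule prod_cases3)
      have "(\<Sum>(i',j',k')\<in>UNIV. A $ i $ i' * B $ j $ j' * C $ k $ k' * (A' $ i' $ i'' * B' $ j' $ j'' * C' $ k' $ k'' * T $ i'' $ j'' $ k''))
        = (\<Sum>i'\<in>UNIV. \<Sum>j'\<in>UNIV. \<Sum>k'\<in>UNIV. (A $ i $ i' * A' $ i' $ i'') * ((B $ j $ j' * B' $ j' $ j'') * ((C $ k $ k' * C' $ k' $ k'') * T $ i'' $ j'' $ k'')))"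
        unfolding sum_triple by (simp add: mult_ac)
      also have "\<dots> = (A ** A') $ i $ i'' * (B ** B') $ j $ j'' * (C ** C') $ k $ k'' * T $ i'' $ j'' $ k''"
        by (simp add: matrix_matrix_mult_def flip: sum_distrib_left sum_distrib_right)
      finally show "(\<Sum>x\<in>UNIV. case x of (i',j',k') \<Rightarrow> case y of (i'',j'',k'') \<Rightarrow>
        A $ i $ i' * B $ j $ j' * C $ k $ k' * (A' $ i' $ i'' * B' $ j' $ j'' * C' $ k' $ k'' * T $ i'' $ j'' $ k''))
        = (case y of (i'',j'',k'') \<Rightarrow> (A ** A') $ i $ i'' * (B ** B') $ j $ j'' * (C ** C') $ k $ k'' * T $ i'' $ j'' $ k'')"
        unfolding y by simp
    qed
    finally show ?thesis .
  qed
  then show ?thesis by (simp add: vec_eq_iff)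
qed

lemma act_diag: "((diag_matrix d, diag_matrix e, diag_matrix f) \<bullet>\<^sub>t T) $ i $ j $ k = d i * e j * f k * T $ i $ j $ k"
  by (simp add: act_nth diag_matrix_def if_distrib[of "\<lambda>z. _ * z"] if_distrib[of "\<lambda>z. z * _"] cong: if_cong)

lemma act_one: "(mat 1, mat 1, mat 1) \<bullet>\<^sub>t T = T"
  by (simp add: vec_eq_iff act_diag flip: diag_matrix_one)

lemma tendsto_act:
  assumes "(A \<longlongrightarrow> A') F" "(B \<longlongrightarrow> B') F" "(C \<longlongrightarrow> C') F" "(T \<longlongrightarrow> T') F"
  shows "((\<lambda>n. (A n, B n, C n) \<bullet>\<^sub>t T n) \<longlongrightarrow> (A', B', C') \<bullet>\<^sub>t T') F"
  unfolding act_def prod.case by (intro tendsto_intros assms)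

text \<open>Cyclic shift of the tensor factors: statements about the second and third component of
  the moment map are reduced to the first one.\<close>

definition rot :: "('a::finite, 'b::finite, 'c::finite) tensor3 \<Rightarrow> ('b, 'c, 'a) tensor3" where
  "rot T = (\<chi> j k i. T $ i $ j $ k)"

lemma rot_act: "rot ((A, B, C) \<bullet>\<^sub>t T) = (B, C, A) \<bullet>\<^sub>t rot T"
proof -
  have "rot ((A, B, C) \<bullet>\<^sub>t T) $ j $ k $ i = ((B, C, A) \<bullet>\<^sub>t rot T) $ j $ k $ i" for i j k
  proof -
    have "(\<Sum>i'\<in>UNIV. \<Sum>j'\<in>UNIV. \<Sum>k'\<in>UNIV. A $ i $ i' * B $ j $ j' * C $ k $ k' * T $ i' $ j' $ k')
      = (\<Sum>j'\<in>UNIV. \<Sum>i'\<in>UNIV. \<Sum>k'\<in>UNIV. A $ i $ i' * B $ j $ j' * C $ k $ k' * T $ i' $ j' $ k')"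
      by (rule sum.swap)
    also have "\<dots> = (\<Sum>j'\<in>UNIV. \<Sum>k'\<in>UNIV. \<Sum>i'\<in>UNIV. A $ i $ i' * B $ j $ j' * C $ k $ k' * T $ i' $ j' $ k')"
      by (intro sum.cong refl sum.swap)
    finally show ?thesis by (simp add: rot_def act_nth mult_ac)
  qed
  then show ?thesis by (simp add: vec_eq_iff)
qed

text \<open>Gram matrix of the slices \<open>T $ i\<close>: the first component of the moment map
  before division by the squared norm.\<close>

definition gram :: "('a::finite, 'b::finite, 'c::finite) tensor3 \<Rightarrow> complex ^ 'a ^ 'a" where
  "gram T = (\<chi> i l. \<Sum>j\<in>UNIV. \<Sum>k\<in>UNIV. cnj (T $ i $ j $ k) * T $ l $ j $ k)"

lemma moment_map_eq_gram:
  "moment_map T = (1 / (norm T)\<^sup>2) *\<^sub>R (gram T, gram (rot T), gram (rot (rot T)))"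
  unfolding moment_map_def gram_def rot_def
  by (auto simp: vec_eq_iff scaleR_conv_of_real[where 'a = complex] intro: sum.swap)

lemma moment_map_gram:
  "norm T = 1 \<Longrightarrow> moment_map T = (gram T, gram (rot T), gram (rot (rot T)))"
  by (simp add: moment_map_eq_gram)

text \<open>Unitaries on the second and third factor preserve the inner products of the slices.\<close>

lemma gram_act:
  assumes B: "unitary_matrix B" and C: "unitary_matrix C"
  shows "gram ((A, B, C) \<bullet>\<^sub>t T) = (\<chi> i j. cnj (A $ i $ j)) ** gram T ** transpose A"
proof -
  \<comment> \<open>The action is split: \<open>B\<close> and \<open>C\<close> come first and do not
    change the Gram matrix, then \<open>A\<close> forms linear combinations of slices.\<close>
  define S where "S = (mat 1, B, C) \<bullet>\<^sub>t T"
  have S_nth: "S $ i $ j $ k = (C *v (\<chi> k'. (B *v (\<chi> j'. T $ i $ j' $ k')) $ j)) $ k" for i j k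
  proof -
    have "S $ i $ j $ k = (\<Sum>i'\<in>UNIV. if i = i' then (\<Sum>j'\<in>UNIV. \<Sum>k'\<in>UNIV. B $ j $ j' * C $ k $ k' * T $ i' $ j' $ k') else 0)"
      unfolding S_def act_nth mat_def by (intro sum.cong refl) auto
    also have "\<dots> = (\<Sum>j'\<in>UNIV. \<Sum>k'\<in>UNIV. B $ j $ j' * C $ k $ k' * T $ i $ j' $ k')" by simp
    also have "\<dots> = (\<Sum>k'\<in>UNIV. \<Sum>j'\<in>UNIV. B $ j $ j' * C $ k $ k' * T $ i $ j' $ k')" by (rule sum.swap)
    finally show ?thesis by (simp add: matrix_vector_mult_def sum_distrib_left mult_ac)
  qed
  have gS: "gram S $ i $ l = gram T $ i $ l" for i l
  proof -
    have "gram S $ i $ l = (\<Sum>j\<in>UNIV. cinner (C *v (\<chi> k. (B *v (\<chi> j'. T $ i $ j' $ k)) $ j)) (C *v (\<chi> k. (B *v (\<chi> j'. T $ l $ j' $ k)) $ j)))"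
      by (simp add: gram_def cinner_def S_nth)
    also have "\<dots> = (\<Sum>j\<in>UNIV. \<Sum>k\<in>UNIV. cnj ((B *v (\<chi> j'. T $ i $ j' $ k)) $ j) * (B *v (\<chi> j'. T $ l $ j' $ k)) $ j)"
      by (simp only: unitary_cinner[OF C]) (simp add: cinner_def)
    also have "\<dots> = (\<Sum>k\<in>UNIV. cinner (B *v (\<chi> j'. T $ i $ j' $ k)) (B *v (\<chi> j'. T $ l $ j' $ k)))"
      unfolding cinner_def by (rule sum.swap)
    also have "\<dots> = (\<Sum>k\<in>UNIV. \<Sum>j\<in>UNIV. cnj (T $ i $ j $ k) * T $ l $ j $ k)"
      by (simp only: unitary_cinner[OF B]) (simp add: cinner_def)
    also have "\<dots> = gram T $ i $ l" unfolding gram_def by simp (rule sum.swap)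
    finally show ?thesis .
  qed
  have act: "((A, B, C) \<bullet>\<^sub>t T) $ i $ j $ k = (\<Sum>i'\<in>UNIV. A $ i $ i' * S $ i' $ j $ k)" for i j k
  proof -
    have "(A, B, C) \<bullet>\<^sub>t T = (A, mat 1, mat 1) \<bullet>\<^sub>t S" unfolding S_def act_act by simp
    then show ?thesis
      by (simp add: act_nth mat_def if_distrib[of "\<lambda>z. _ * z"] if_distrib[of "\<lambda>z. z * _"] cong: if_cong)
  qed
  have "gram ((A, B, C) \<bullet>\<^sub>t T) $ i $ l = (\<Sum>l'\<in>UNIV. \<Sum>i'\<in>UNIV. cnj (A $ i $ i') * gram S $ i' $ l' * A $ l $ l')" for i l
  proof -
    have "gram ((A, B, C) \<bullet>\<^sub>t T) $ i $ l = (\<Sum>(j,k)\<in>UNIV. \<Sum>(i',l')\<in>UNIV. cnj (A $ i $ i') * cnj (S $ i' $ j $ k) * (A $ l $ l' * S $ l' $ j $ k))"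
    proof -
      have "cnj (((A, B, C) \<bullet>\<^sub>t T) $ i $ j $ k) * ((A, B, C) \<bullet>\<^sub>t T) $ l $ j $ k =
        (\<Sum>(i',l')\<in>UNIV. cnj (A $ i $ i') * cnj (S $ i' $ j $ k) * (A $ l $ l' * S $ l' $ j $ k))" for j k
        by (simp add: act sum_product flip: sum_double)
      then show ?thesis by (simp only: gram_def vec_lambda_beta flip: sum_double)
    qed
    also have "\<dots> = (\<Sum>(i',l')\<in>UNIV. \<Sum>(j,k)\<in>UNIV. cnj (A $ i $ i') * cnj (S $ i' $ j $ k) * (A $ l $ l' * S $ l' $ j $ k))"
      unfolding case_prod_unfold by (rule sum.swap)
    also have "\<dots> = (\<Sum>(i',l')\<in>UNIV. cnj (A $ i $ i') * (\<Sum>(j,k)\<in>UNIV. cnj (S $ i' $ j $ k) * S $ l' $ j $ k) * A $ l $ l')"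
      by (simp add: case_prod_unfold sum_distrib_left sum_distrib_right mult_ac)
    also have "\<dots> = (\<Sum>i'\<in>UNIV. \<Sum>l'\<in>UNIV. cnj (A $ i $ i') * gram S $ i' $ l' * A $ l $ l')"
      by (simp add: gram_def sum.cartesian_product flip: UNIV_Times_UNIV)
    also have "\<dots> = (\<Sum>l'\<in>UNIV. \<Sum>i'\<in>UNIV. cnj (A $ i $ i') * gram S $ i' $ l' * A $ l $ l')"
      by (rule sum.swap)
    finally show ?thesis .
  qed
  then show ?thesis
    by (simp add: vec_eq_iff gS matrix_matrix_mult_def transpose_def sum_distrib_right)
qed

section \<open>Uniqueness of limits with equal moments\<close>

text \<open>With \<open>d = |X|\<^sup>2 - |Y|\<^sup>2\<close> and \<open>a\<close> the logarithm of the scaling factor of the \<open>n\<close>-th term,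
  equality of the marginals makes the sum of \<open>d * a\<close> vanish for every \<open>n\<close>, while each summand
  with \<open>d \<noteq> 0\<close> is eventually positive.\<close>

lemma diagonal_scaling_limit_unique:
  fixes X Y :: "('a::finite, 'b::finite, 'c::finite) tensor3"
  assumes x: "x \<longlonglongrightarrow> X" and y: "y \<longlonglongrightarrow> Y"
    and pos: "\<And>n i. \<alpha> n i > 0" "\<And>n j. \<beta> n j > 0" "\<And>n k. \<gamma> n k > (0::real)"
    and xy: "\<And>n. x n = (diag_matrix (\<lambda>i. of_real (\<alpha> n i)), diag_matrix (\<lambda>j. of_real (\<beta> n j)),
       diag_matrix (\<lambda>k. of_real (\<gamma> n k))) \<bullet>\<^sub>t y n"
    and m1: "\<And>i. (\<Sum>j\<in>UNIV. \<Sum>k\<in>UNIV. (cmod (X $ i $ j $ k))\<^sup>2) = (\<Sum>j\<in>UNIV. \<Sum>k\<in>UNIV. (cmod (Y $ i $ j $ k))\<^sup>2)"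
    and m2: "\<And>j. (\<Sum>i\<in>UNIV. \<Sum>k\<in>UNIV. (cmod (X $ i $ j $ k))\<^sup>2) = (\<Sum>i\<in>UNIV. \<Sum>k\<in>UNIV. (cmod (Y $ i $ j $ k))\<^sup>2)"
    and m3: "\<And>k. (\<Sum>i\<in>UNIV. \<Sum>j\<in>UNIV. (cmod (X $ i $ j $ k))\<^sup>2) = (\<Sum>i\<in>UNIV. \<Sum>j\<in>UNIV. (cmod (Y $ i $ j $ k))\<^sup>2)"
  shows "X = Y"
proof -
  define d where "d i j k = (cmod (X $ i $ j $ k))\<^sup>2 - (cmod (Y $ i $ j $ k))\<^sup>2" for i j k
  define a where "a n i j k = ln (\<alpha> n i) + ln (\<beta> n j) + ln (\<gamma> n k)" for n i j k
  have lx: "(\<lambda>n. x n $ i $ j $ k) \<longlonglongrightarrow> X $ i $ j $ k" for i j k by (intro tendsto_vec_nth x)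
  have ly: "(\<lambda>n. y n $ i $ j $ k) \<longlonglongrightarrow> Y $ i $ j $ k" for i j k by (intro tendsto_vec_nth y)
  have xa: "x n $ i $ j $ k = of_real (exp (a n i j k)) * y n $ i $ j $ k" for n i j k
    using pos by (simp add: xy act_diag a_def exp_add)
  have nx: "cmod (x n $ i $ j $ k) = exp (a n i j k) * cmod (y n $ i $ j $ k)" for n i j k
    by (simp add: xa norm_mult del: of_real_exp)
  \<comment> \<open>Each of the three logarithms depends on one index only, so summing
    \<open>d\<close> over the other two indices leaves a difference of equal marginals.\<close>
  have zero: "(\<Sum>(i,j,k)\<in>UNIV. d i j k * a n i j k) = 0" for n
  proof -
    have "(\<Sum>i\<in>UNIV. \<Sum>j\<in>UNIV. \<Sum>k\<in>UNIV. d i j k * ln (\<alpha> n i)) = (\<Sum>i\<in>UNIV. (\<Sum>j\<in>UNIV. \<Sum>k\<in>UNIV. d i j k) * ln (\<alpha> n i))"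
      by (simp add: sum_distrib_right)
    also have "\<dots> = 0" by (simp add: d_def sum_subtractf m1)
    finally have 1: "(\<Sum>i\<in>UNIV. \<Sum>j\<in>UNIV. \<Sum>k\<in>UNIV. d i j k * ln (\<alpha> n i)) = 0" .
    have "(\<Sum>i\<in>UNIV. \<Sum>j\<in>UNIV. \<Sum>k\<in>UNIV. d i j k * ln (\<beta> n j)) = (\<Sum>j\<in>UNIV. \<Sum>i\<in>UNIV. \<Sum>k\<in>UNIV. d i j k * ln (\<beta> n j))"
      by (rule sum.swap)
    also have "\<dots> = (\<Sum>j\<in>UNIV. (\<Sum>i\<in>UNIV. \<Sum>k\<in>UNIV. d i j k) * ln (\<beta> n j))"
      by (simp add: sum_distrib_right)
    also have "\<dots> = 0" by (simp add: d_def sum_subtractf m2)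
    finally have 2: "(\<Sum>i\<in>UNIV. \<Sum>j\<in>UNIV. \<Sum>k\<in>UNIV. d i j k * ln (\<beta> n j)) = 0" .
    have "(\<Sum>i\<in>UNIV. \<Sum>j\<in>UNIV. \<Sum>k\<in>UNIV. d i j k * ln (\<gamma> n k)) = (\<Sum>i\<in>UNIV. \<Sum>k\<in>UNIV. \<Sum>j\<in>UNIV. d i j k * ln (\<gamma> n k))"
      by (intro sum.cong refl sum.swap)
    also have "\<dots> = (\<Sum>k\<in>UNIV. \<Sum>i\<in>UNIV. \<Sum>j\<in>UNIV. d i j k * ln (\<gamma> n k))"
      by (rule sum.swap)
    also have "\<dots> = (\<Sum>k\<in>UNIV. (\<Sum>i\<in>UNIV. \<Sum>j\<in>UNIV. d i j k) * ln (\<gamma> n k))"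
      by (simp add: sum_distrib_right)
    also have "\<dots> = 0" by (simp add: d_def sum_subtractf m3)
    finally have 3: "(\<Sum>i\<in>UNIV. \<Sum>j\<in>UNIV. \<Sum>k\<in>UNIV. d i j k * ln (\<gamma> n k)) = 0" .
    have "(\<Sum>i\<in>UNIV. \<Sum>j\<in>UNIV. \<Sum>k\<in>UNIV. d i j k * a n i j k) = 0"
      using 1 2 3 by (simp add: a_def distrib_left sum.distrib)
    then show ?thesis by (simp add: sum_triple)
  qed
  have evless: "\<forall>\<^sub>F n in sequentially. f n < g n" if "f \<longlonglongrightarrow> l" "g \<longlonglongrightarrow> m" "l < m" for f g :: "nat \<Rightarrow> real" and l m
    using order_tendstoD(1)[OF tendsto_diff[OF that(2,1)], of 0] that(3) by simp
  have ev: "\<forall>\<^sub>F n in sequentially. d i j k \<noteq> 0 \<longrightarrow> d i j k * a n i j k > 0" for i j k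
  proof (cases "d i j k" "0 :: real" rule: linorder_cases)
    case less
    then have "cmod (X $ i $ j $ k) < cmod (Y $ i $ j $ k)"
      by (metis d_def diff_less_0_iff_less norm_ge_zero power2_less_imp_less)
    then have "\<forall>\<^sub>F n in sequentially. cmod (x n $ i $ j $ k) < cmod (y n $ i $ j $ k)"
      by (rule evless[OF tendsto_norm[OF lx] tendsto_norm[OF ly]])
    then show ?thesis
    proof eventually_elim
      case (elim n)
      then have "exp (a n i j k) < 1"
        unfolding nx using mult_right_mono[of 1 "exp (a n i j k)" "cmod (y n $ i $ j $ k)"] by fastforce
      then show ?case using less by (simp add: mult_neg_neg)
    qed
  next
    case greater
    then have "cmod (Y $ i $ j $ k) < cmod (X $ i $ j $ k)"
      by (metis d_def diff_gt_0_iff_gt norm_ge_zero power2_less_imp_less)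
    then have "\<forall>\<^sub>F n in sequentially. cmod (y n $ i $ j $ k) < cmod (x n $ i $ j $ k)"
      by (rule evless[OF tendsto_norm[OF ly] tendsto_norm[OF lx]])
    then show ?thesis
    proof eventually_elim
      case (elim n)
      then have "exp (a n i j k) > 1"
        unfolding nx using mult_right_mono[of "exp (a n i j k)" 1 "cmod (y n $ i $ j $ k)"] by fastforce
      then show ?case using greater by simp
    qed
  qed simp
  \<comment> \<open>There are finitely many triples, so a single n serves all of them; the
    contradiction needs just one.\<close>
  have "\<forall>\<^sub>F n in sequentially. \<forall>i j k. d i j k \<noteq> 0 \<longrightarrow> d i j k * a n i j k > 0"
    by (intro eventually_all_finite ev)
  then obtain n where n: "\<And>i j k. d i j k \<noteq> 0 \<Longrightarrow> d i j k * a n i j k > 0"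
    using eventually_happens sequentially_bot by blast
  have d0: "d i j k = 0" for i j k
  proof (rule ccontr)
    assume nz: "d i j k \<noteq> 0"
    have "(\<Sum>(i,j,k)\<in>UNIV. d i j k * a n i j k) > 0"
    proof (rule sum_pos2[of _ "(i,j,k)"])
      show "0 \<le> (case w of (i,j,k) \<Rightarrow> d i j k * a n i j k)" for w
        by (cases w) (metis (mono_tags, lifting) case_prod_conv less_imp_le mult_zero_left n order_refl)
    qed (use n[OF nz] in auto)
    with zero show False by simp
  qed
  have "X $ i $ j $ k = Y $ i $ j $ k" for i j k
  proof -
    have eq: "cmod (X $ i $ j $ k) = cmod (Y $ i $ j $ k)" using d0[of i j k] by (simp add: d_def)
    \<comment> \<open>Moduli agree; now the phases. Positive scaling gives |x_n| y_n = |y_n| x_n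
      entrywise, and this relation passes to the limit although the scaling factors may
      diverge.\<close>
    have "(\<lambda>n. of_real (cmod (x n $ i $ j $ k)) * y n $ i $ j $ k) \<longlonglongrightarrow> of_real (cmod (X $ i $ j $ k)) * Y $ i $ j $ k"
      by (intro tendsto_intros lx ly)
    moreover have "(\<lambda>n. of_real (cmod (y n $ i $ j $ k)) * x n $ i $ j $ k) \<longlonglongrightarrow> of_real (cmod (Y $ i $ j $ k)) * X $ i $ j $ k"
      by (intro tendsto_intros lx ly)
    moreover have "of_real (cmod (x n $ i $ j $ k)) * y n $ i $ j $ k = of_real (cmod (y n $ i $ j $ k)) * x n $ i $ j $ k" for n
      unfolding nx by (simp add: xa mult_ac)
    ultimately have "of_real (cmod (X $ i $ j $ k)) * Y $ i $ j $ k = of_real (cmod (Y $ i $ j $ k)) * X $ i $ j $ k"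
      using LIMSEQ_unique by simp
    then show ?thesis using eq by (cases "Y $ i $ j $ k = 0") auto
  qed
  then show ?thesis by (simp add: vec_eq_iff)
qed

section \<open>Moments under unitary matrices and the Kempf-Ness comparison\<close>

lemma gram_diag: "gram T $ i $ i = of_real (\<Sum>j\<in>UNIV. \<Sum>k\<in>UNIV. (cmod (T $ i $ j $ k))\<^sup>2)"
  by (simp add: gram_def complex_norm_square mult.commute del: of_real_power)

lemma gram_rot_diag: "gram (rot T) $ j $ j = of_real (\<Sum>i\<in>UNIV. \<Sum>k\<in>UNIV. (cmod (T $ i $ j $ k))\<^sup>2)"
  unfolding gram_diag by (subst sum.swap) (simp add: rot_def)

lemma gram_rot_rot_diag: "gram (rot (rot T)) $ k $ k = of_real (\<Sum>i\<in>UNIV. \<Sum>j\<in>UNIV. (cmod (T $ i $ j $ k))\<^sup>2)"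
  unfolding gram_diag by (simp add: rot_def)

lemma unitary_cnj: "unitary_matrix A \<Longrightarrow> unitary_matrix (\<chi> i j. cnj (A $ i $ j))"
  using unitary_transpose[OF unitary_adjoint] by (simp add: transpose_def adjoint_matrix_def)

lemma norm_gram_act:
  assumes "unitary_matrix A" "unitary_matrix B" "unitary_matrix C"
  shows "norm (gram ((A, B, C) \<bullet>\<^sub>t T)) = norm (gram T)"
  unfolding gram_act[OF assms(2,3)]
  by (simp add: unitary_norm_mult_left unitary_norm_mult_right unitary_cnj unitary_transpose assms(1))

text \<open>A block diagonal \<open>A\<close> commutes with the diagonal matrix of the same
  \<open>p\<close>, so the two unitary factors around it cancel.\<close>

lemma gram_act_diag:
  assumes "unitary_matrix A" "unitary_matrix B" "unitary_matrix C"
    and A: "block_diagonal p A" and T: "gram T = diag_matrix (\<lambda>i. of_real (p i))"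
  shows "gram ((A, B, C) \<bullet>\<^sub>t T) = diag_matrix (\<lambda>i. of_real (p i))"
proof -
  define D where "D = diag_matrix (\<lambda>i. complex_of_real (p i))"
  have "D ** transpose A = transpose A ** D"
  proof -
    have "of_real (p i) * A $ j $ i = A $ j $ i * of_real (p j)" for i j
      using A by (cases "A $ j $ i = 0") (auto simp: block_diagonal_def)
    then show ?thesis
      by (simp add: D_def diag_matrix_def matrix_matrix_mult_def transpose_def vec_eq_iff
          if_distrib[of "\<lambda>z. _ * z"] if_distrib[of "\<lambda>z. z * _"] cong: if_cong)
  qed
  then have "gram ((A, B, C) \<bullet>\<^sub>t T) = ((\<chi> i j. cnj (A $ i $ j)) ** transpose A) ** D"
    unfolding gram_act[OF assms(2,3)] T D_def[symmetric] by (metis matrix_mul_assoc)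
  also have "(\<chi> i j. cnj (A $ i $ j)) = adjoint_matrix (transpose A)"
    by (simp add: adjoint_matrix_def transpose_def)
  finally show ?thesis using unitary_transpose[OF assms(1)] by (simp add: unitary_matrix_def D_def)
qed

text \<open>The squared norm is the trace of the Gram matrix, which unitaries merely
  conjugate.\<close>

lemma norm_act:
  assumes "unitary_matrix A" "unitary_matrix B" "unitary_matrix C"
  shows "norm ((A, B, C) \<bullet>\<^sub>t T) = norm T"
proof -
  have tr: "(norm T)\<^sup>2 = Re (trace (gram T))" for T :: "('a, 'b, 'c) tensor3"
    by (simp add: trace_def gram_diag norm_tensor_sq)
  have "trace (gram ((A, B, C) \<bullet>\<^sub>t T)) = trace (adjoint_matrix (transpose A) ** (gram T ** transpose A))"
    unfolding gram_act[OF assms(2,3)] matrix_mul_assoc by (simp add: adjoint_matrix_def transpose_def)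
  also have "\<dots> = trace (gram T ** (transpose A ** adjoint_matrix (transpose A)))"
    by (subst trace_mul_sym) (simp add: matrix_mul_assoc)
  also have "\<dots> = trace (gram T)"
    using unitary_transpose[OF assms(1)] by (simp add: unitary_matrix_def)
  finally have "(norm ((A, B, C) \<bullet>\<^sub>t T))\<^sup>2 = (norm T)\<^sup>2" unfolding tr by simp
  then show ?thesis by simp
qed

text \<open>Stated for Gram matrices, without normalisation; for a unit vector it says that the
  moment map equals the diagonal triple (p, q, r).\<close>

definition has_moment :: "('a \<Rightarrow> real) \<Rightarrow> ('b \<Rightarrow> real) \<Rightarrow> ('c \<Rightarrow> real) \<Rightarrow>
    ('a::finite, 'b::finite, 'c::finite) tensor3 \<Rightarrow> bool" where
  "has_moment p q r T \<longleftrightarrow> gram T = diag_matrix (\<lambda>i. of_real (p i)) \<and>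
    gram (rot T) = diag_matrix (\<lambda>i. of_real (q i)) \<and> gram (rot (rot T)) = diag_matrix (\<lambda>i. of_real (r i))"

lemma has_moment_act:
  assumes "has_moment p q r T" "unitary_matrix A" "unitary_matrix B" "unitary_matrix C"
    "block_diagonal p A" "block_diagonal q B" "block_diagonal r C"
  shows "has_moment p q r ((A, B, C) \<bullet>\<^sub>t T)"
  using assms unfolding has_moment_def rot_act by (auto intro: gram_act_diag)

lemma has_moment_marginals:
  assumes "has_moment p q r T"
  shows "(\<Sum>j\<in>UNIV. \<Sum>k\<in>UNIV. (cmod (T $ i $ j $ k))\<^sup>2) = p i"
    and "(\<Sum>i\<in>UNIV. \<Sum>k\<in>UNIV. (cmod (T $ i $ j $ k))\<^sup>2) = q j"
    and "(\<Sum>i\<in>UNIV. \<Sum>j\<in>UNIV. (cmod (T $ i $ j $ k))\<^sup>2) = r k"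
  using assms gram_diag[of T i] gram_rot_diag[of T j] gram_rot_rot_diag[of T k]
  unfolding has_moment_def of_real_eq_iff[where 'a = complex, symmetric]
  by (simp_all add: diag_matrix_def)

text \<open>Kempf-Ness uniqueness for the centraliser of (p, q, r), in a form for limits. The
  singular value decomposition turns the group elements into positive diagonal scalings between
  unitarily moved sequences. The unitaries converge along a subsequence, and being block diagonal
  they preserve the moment, so the uniqueness of diagonal scaling limits applies.\<close>

lemma kempf_ness_block:
  fixes X Y :: "('a::finite, 'b::finite, 'c::finite) tensor3"
  assumes Y: "y \<longlonglongrightarrow> Y" and X: "(\<lambda>n. (A n, B n, C n) \<bullet>\<^sub>t y n) \<longlonglongrightarrow> X"
    and inv: "\<And>n. invertible (A n)" "\<And>n. invertible (B n)" "\<And>n. invertible (C n)"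
    and bl: "\<And>n. block_diagonal p (A n)" "\<And>n. block_diagonal q (B n)" "\<And>n. block_diagonal r (C n)"
    and mom: "has_moment p q r X" "has_moment p q r Y"
  obtains k where "k \<in> U" "k \<bullet>\<^sub>t X = Y"
proof -
  have "\<exists>s t d. unitary_matrix s \<and> block_diagonal p s \<and> unitary_matrix t \<and> block_diagonal p t \<and>
    (\<forall>i. d i > 0) \<and> s ** A n = diag_matrix (\<lambda>i. of_real (d i)) ** t" for n
    using singular_value_decomposition[OF bl(1)[of n] inv(1)[of n]] by metis
  then obtain s1 t1 d1 where 1: "\<And>n. unitary_matrix (s1 n)" "\<And>n. block_diagonal p (s1 n)"
    "\<And>n. unitary_matrix (t1 n)" "\<And>n. block_diagonal p (t1 n)" "\<And>n i. d1 n i > 0"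
    "\<And>n. s1 n ** A n = diag_matrix (\<lambda>i. of_real (d1 n i)) ** t1 n" by metis
  have "\<exists>s t d. unitary_matrix s \<and> block_diagonal q s \<and> unitary_matrix t \<and> block_diagonal q t \<and>
    (\<forall>i. d i > 0) \<and> s ** B n = diag_matrix (\<lambda>i. of_real (d i)) ** t" for n
    using singular_value_decomposition[OF bl(2)[of n] inv(2)[of n]] by metis
  then obtain s2 t2 d2 where 2: "\<And>n. unitary_matrix (s2 n)" "\<And>n. block_diagonal q (s2 n)"
    "\<And>n. unitary_matrix (t2 n)" "\<And>n. block_diagonal q (t2 n)" "\<And>n i. d2 n i > 0"
    "\<And>n. s2 n ** B n = diag_matrix (\<lambda>i. of_real (d2 n i)) ** t2 n" by metis
  have "\<exists>s t d. unitary_matrix s \<and> block_diagonal r s \<and> unitary_matrix t \<and> block_diagonal r t \<and>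
    (\<forall>i. d i > 0) \<and> s ** C n = diag_matrix (\<lambda>i. of_real (d i)) ** t" for n
    using singular_value_decomposition[OF bl(3)[of n] inv(3)[of n]] by metis
  then obtain s3 t3 d3 where 3: "\<And>n. unitary_matrix (s3 n)" "\<And>n. block_diagonal r (s3 n)"
    "\<And>n. unitary_matrix (t3 n)" "\<And>n. block_diagonal r (t3 n)" "\<And>n i. d3 n i > 0"
    "\<And>n. s3 n ** C n = diag_matrix (\<lambda>i. of_real (d3 n i)) ** t3 n" by metis
  let ?K = "\<lambda>p. {A. unitary_matrix A \<and> block_diagonal p A}"
  let ?f = "\<lambda>n. ((s1 n, s2 n, s3 n), (t1 n, t2 n, t3 n))"
  have cpt: "compact ((?K p \<times> ?K q \<times> ?K r) \<times> (?K p \<times> ?K q \<times> ?K r))"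
    by (intro compact_Times compact_block_unitary)
  have mem: "\<forall>n. ?f n \<in> (?K p \<times> ?K q \<times> ?K r) \<times> (?K p \<times> ?K q \<times> ?K r)"
    using 1 2 3 by simp
  obtain l \<phi> where l: "l \<in> (?K p \<times> ?K q \<times> ?K r) \<times> (?K p \<times> ?K q \<times> ?K r)"
    and \<phi>: "strict_mono (\<phi> :: nat \<Rightarrow> nat)" "(?f \<circ> \<phi>) \<longlonglongrightarrow> l"
    using cpt mem unfolding compact_def by meson
  obtain S1 S2 S3 T1 T2 T3 where leq: "l = ((S1, S2, S3), (T1, T2, T3))"
    by (metis prod.exhaust)
  have K: "unitary_matrix S1" "unitary_matrix S2" "unitary_matrix S3" "unitary_matrix T1" "unitary_matrix T2" "unitary_matrix T3"
    "block_diagonal p S1" "block_diagonal q S2" "block_diagonal r S3" "block_diagonal p T1" "block_diagonal q T2" "block_diagonal r T3"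
    using l by (auto simp: leq)
  have "(\<lambda>n. ?f (\<phi> n)) \<longlonglongrightarrow> ((S1, S2, S3), (T1, T2, T3))" using \<phi>(2) by (simp add: o_def leq)
  note lim = tendsto_fst[OF this] tendsto_snd[OF this]
  have limS: "(\<lambda>n. s1 (\<phi> n)) \<longlonglongrightarrow> S1" "(\<lambda>n. s2 (\<phi> n)) \<longlonglongrightarrow> S2" "(\<lambda>n. s3 (\<phi> n)) \<longlonglongrightarrow> S3"
    using tendsto_fst[OF lim(1)] tendsto_fst[OF tendsto_snd[OF lim(1)]] tendsto_snd[OF tendsto_snd[OF lim(1)]] by simp_all
  have limT: "(\<lambda>n. t1 (\<phi> n)) \<longlonglongrightarrow> T1" "(\<lambda>n. t2 (\<phi> n)) \<longlonglongrightarrow> T2" "(\<lambda>n. t3 (\<phi> n)) \<longlonglongrightarrow> T3"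
    using tendsto_fst[OF lim(2)] tendsto_fst[OF tendsto_snd[OF lim(2)]] tendsto_snd[OF tendsto_snd[OF lim(2)]] by simp_all
  define x' where "x' n = (s1 (\<phi> n), s2 (\<phi> n), s3 (\<phi> n)) \<bullet>\<^sub>t ((A (\<phi> n), B (\<phi> n), C (\<phi> n)) \<bullet>\<^sub>t y (\<phi> n))" for n
  define y' where "y' n = (t1 (\<phi> n), t2 (\<phi> n), t3 (\<phi> n)) \<bullet>\<^sub>t y (\<phi> n)" for n
  have x': "x' \<longlonglongrightarrow> (S1, S2, S3) \<bullet>\<^sub>t X"
    unfolding x'_def using LIMSEQ_subseq_LIMSEQ[OF X \<phi>(1)] by (intro tendsto_act limS) (simp add: o_def)
  have y': "y' \<longlonglongrightarrow> (T1, T2, T3) \<bullet>\<^sub>t Y"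
    unfolding y'_def using LIMSEQ_subseq_LIMSEQ[OF Y \<phi>(1)] by (intro tendsto_act limT) (simp add: o_def)
  have mX: "has_moment p q r ((S1, S2, S3) \<bullet>\<^sub>t X)" and mY: "has_moment p q r ((T1, T2, T3) \<bullet>\<^sub>t Y)"
    using mom K by (auto intro: has_moment_act)
  have eq: "(S1, S2, S3) \<bullet>\<^sub>t X = (T1, T2, T3) \<bullet>\<^sub>t Y"
  proof (rule diagonal_scaling_limit_unique[OF x' y', of "\<lambda>n. d1 (\<phi> n)" "\<lambda>n. d2 (\<phi> n)" "\<lambda>n. d3 (\<phi> n)"])
    show "x' n = (diag_matrix (\<lambda>i. of_real (d1 (\<phi> n) i)), diag_matrix (\<lambda>i. of_real (d2 (\<phi> n) i)),
      diag_matrix (\<lambda>i. of_real (d3 (\<phi> n) i))) \<bullet>\<^sub>t y' n" for n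
      unfolding x'_def y'_def act_act 1(6) 2(6) 3(6) ..
  qed (simp_all add: 1 2 3 has_moment_marginals[OF mX] has_moment_marginals[OF mY])
  let ?k = "(adjoint_matrix T1 ** S1, adjoint_matrix T2 ** S2, adjoint_matrix T3 ** S3)"
  have "?k \<bullet>\<^sub>t X = (adjoint_matrix T1, adjoint_matrix T2, adjoint_matrix T3) \<bullet>\<^sub>t ((T1, T2, T3) \<bullet>\<^sub>t Y)"
    unfolding eq[symmetric] act_act ..
  also have "\<dots> = Y" using K unfolding act_act unitary_matrix_def by (simp add: act_one)
  finally have "?k \<bullet>\<^sub>t X = Y" .
  moreover have "?k \<in> U" unfolding U_def using K by (simp add: unitary_mult unitary_adjoint)
  ultimately show ?thesis using that by blast
qed

section \<open>Free tensors\<close>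

text \<open>Weights of the diagonal torus: the torus element with logarithm h multiplies the entry
  at \<omega> by exp of \<open>h \<bullet> weight \<omega>\<close>.\<close>

definition weight :: "'a::finite \<times> 'b::finite \<times> 'c::finite \<Rightarrow> (real ^ 'a) \<times> (real ^ 'b) \<times> (real ^ 'c)" where
  "weight = (\<lambda>(i, j, k). (axis i 1, axis j 1, axis k 1))"

lemma inner_weight: "x \<bullet> weight (i, j, k) = fst x $ i + fst (snd x) $ j + snd (snd x) $ k"
  by (cases x) (simp add: weight_def inner_axis)

text \<open>The squared Euclidean norm of the point (p, q, r), not the norm itself.\<close>

definition moment_norm :: "('a::finite \<Rightarrow> real) \<Rightarrow> ('b::finite \<Rightarrow> real) \<Rightarrow> ('c::finite \<Rightarrow> real) \<Rightarrow> real" where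
  "moment_norm p q r = (\<Sum>i\<in>UNIV. (p i)\<^sup>2) + (\<Sum>j\<in>UNIV. (q j)\<^sup>2) + (\<Sum>k\<in>UNIV. (r k)\<^sup>2)"

text \<open>An off-diagonal Gram entry sums products of two tensor entries whose positions differ in
  exactly one coordinate; in a free support one of the two vanishes.\<close>

lemma free_gram:
  assumes "free_set (supp T)"
  shows "gram T = diag_matrix (\<lambda>i. gram T $ i $ i)"
    and "gram (rot T) = diag_matrix (\<lambda>i. gram (rot T) $ i $ i)"
    and "gram (rot (rot T)) = diag_matrix (\<lambda>i. gram (rot (rot T)) $ i $ i)"
proof -
  have 1: "T $ i $ j $ k = 0 \<or> T $ l $ j $ k = 0" if "i \<noteq> l" for i l j k
    using assms that by (fastforce simp: free_set_def supp_def)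
  have 2: "T $ i $ j $ k = 0 \<or> T $ i $ l $ k = 0" if "j \<noteq> l" for i l j k
    using assms that by (fastforce simp: free_set_def supp_def)
  have 3: "T $ i $ j $ k = 0 \<or> T $ i $ j $ l = 0" if "k \<noteq> l" for i l j k
    using assms that by (fastforce simp: free_set_def supp_def)
  show "gram T = diag_matrix (\<lambda>i. gram T $ i $ i)"
    using 1 by (fastforce simp: vec_eq_iff diag_matrix_def gram_def intro!: sum.neutral)
  show "gram (rot T) = diag_matrix (\<lambda>i. gram (rot T) $ i $ i)"
    using 2 by (fastforce simp: vec_eq_iff diag_matrix_def gram_def rot_def intro!: sum.neutral)
  show "gram (rot (rot T)) = diag_matrix (\<lambda>i. gram (rot (rot T)) $ i $ i)"
    using 3 by (fastforce simp: vec_eq_iff diag_matrix_def gram_def rot_def intro!: sum.neutral)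
qed

lemma sum_weighted_marginals:
  fixes f :: "'a::finite \<Rightarrow> 'b::finite \<Rightarrow> 'c::finite \<Rightarrow> real"
  shows "(\<Sum>i\<in>UNIV. \<Sum>j\<in>UNIV. \<Sum>k\<in>UNIV. f i j k * (p i + q j + r k)) =
    (\<Sum>i\<in>UNIV. (\<Sum>j\<in>UNIV. \<Sum>k\<in>UNIV. f i j k) * p i) + (\<Sum>j\<in>UNIV. (\<Sum>i\<in>UNIV. \<Sum>k\<in>UNIV. f i j k) * q j)
      + (\<Sum>k\<in>UNIV. (\<Sum>i\<in>UNIV. \<Sum>j\<in>UNIV. f i j k) * r k)"
proof -
  have "(\<Sum>i\<in>UNIV. \<Sum>j\<in>UNIV. \<Sum>k\<in>UNIV. f i j k * q j) = (\<Sum>j\<in>UNIV. (\<Sum>i\<in>UNIV. \<Sum>k\<in>UNIV. f i j k) * q j)"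
    by (subst sum.swap) (simp add: sum_distrib_right)
  moreover have "(\<Sum>i\<in>UNIV. \<Sum>j\<in>UNIV. \<Sum>k\<in>UNIV. f i j k * r k) = (\<Sum>k\<in>UNIV. (\<Sum>i\<in>UNIV. \<Sum>j\<in>UNIV. f i j k) * r k)"
  proof -
    have "(\<Sum>i\<in>UNIV. \<Sum>j\<in>UNIV. \<Sum>k\<in>UNIV. f i j k * r k) = (\<Sum>i\<in>UNIV. \<Sum>k\<in>UNIV. \<Sum>j\<in>UNIV. f i j k * r k)"
      by (intro sum.cong refl sum.swap)
    also have "\<dots> = (\<Sum>k\<in>UNIV. \<Sum>i\<in>UNIV. \<Sum>j\<in>UNIV. f i j k * r k)" by (rule sum.swap)
    finally show ?thesis by (simp add: sum_distrib_right)
  qed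
  ultimately show ?thesis by (simp add: distrib_left sum.distrib sum_distrib_right)
qed

text \<open>The squared moduli of the entries are probability weights. Their mean of p i + q j + r k
  is \<open>moment_norm p q r\<close>, which is also a lower bound on the support, so the bound is
  attained wherever the weight is positive.\<close>

lemma supp_on_face:
  fixes T :: "('a::finite, 'b::finite, 'c::finite) tensor3"
  assumes T: "has_moment p q r T" "norm T = 1"
    and ge: "\<And>i j k. T $ i $ j $ k \<noteq> 0 \<Longrightarrow> moment_norm p q r \<le> p i + q j + r k"
    and nz: "T $ i $ j $ k \<noteq> 0"
  shows "p i + q j + r k = moment_norm p q r"
proof -
  let ?g = "\<lambda>i j k. (cmod (T $ i $ j $ k))\<^sup>2 * (p i + q j + r k - moment_norm p q r)"
  have "(\<Sum>i\<in>UNIV. \<Sum>j\<in>UNIV. \<Sum>k\<in>UNIV. ?g i j k) =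
    (\<Sum>i\<in>UNIV. \<Sum>j\<in>UNIV. \<Sum>k\<in>UNIV. (cmod (T $ i $ j $ k))\<^sup>2 * (p i + q j + r k)) - (norm T)\<^sup>2 * moment_norm p q r"
    unfolding norm_tensor_sq by (simp add: right_diff_distrib sum_subtractf sum_distrib_right)
  also have "\<dots> = 0"
    unfolding sum_weighted_marginals has_moment_marginals[OF T(1)]
    by (simp add: T(2) moment_norm_def power2_eq_square)
  finally have s: "(\<Sum>(i,j,k)\<in>UNIV. ?g i j k) = 0" by (simp add: sum_triple)
  have "\<forall>x\<in>UNIV. (case x of (i,j,k) \<Rightarrow> ?g i j k) = 0"
  proof (rule sum_nonneg_eq_0_iff[THEN iffD1, OF _ _ s])
    show "0 \<le> (case x of (i,j,k) \<Rightarrow> ?g i j k)" for x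
    proof (cases x)
      case (fields i j k)
      then show ?thesis using ge[of i j k] by (cases "T $ i $ j $ k = 0") auto
    qed
  qed simp
  then have "?g i j k = 0" by fastforce
  then show ?thesis using nz by simp
qed

lemma free_set_mono: "free_set F \<Longrightarrow> G \<subseteq> F \<Longrightarrow> free_set G"
  unfolding free_set_def by (clarsimp split: prod.splits) (metis subsetD)

text \<open>The minimising sequence is applied to the squared moduli of the entries. This controls
  only the marginals of the limit; freeness of the support makes its Gram matrices diagonal, so that
  the marginals determine the whole moment.\<close>

lemma free_torus_limit:
  fixes T :: "('a::finite, 'b::finite, 'c::finite) tensor3"
  assumes free: "free_set (supp T)" and T0: "T \<noteq> 0"
  obtains p q r and \<alpha> \<beta> \<gamma> :: "nat \<Rightarrow> _ \<Rightarrow> real" and S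
  where "\<And>n i. \<alpha> n i > 0" "\<And>n j. \<beta> n j > 0" "\<And>n k. \<gamma> n k > 0"
    "(\<lambda>n. (diag_matrix (\<lambda>i. of_real (\<alpha> n i)), diag_matrix (\<lambda>j. of_real (\<beta> n j)),
       diag_matrix (\<lambda>k. of_real (\<gamma> n k))) \<bullet>\<^sub>t T) \<longlonglongrightarrow> S"
    "norm S = 1" "has_moment p q r S" "supp S \<subseteq> supp T"
    "\<And>i j k. (i, j, k) \<in> supp T \<Longrightarrow> moment_norm p q r \<le> p i + q j + r k"
proof -
  define P where "P = closest_point (convex hull (weight ` supp T)) 0"
  have ne: "supp T \<noteq> {}" using T0 by (auto simp: supp_def vec_eq_iff)
  have cl: "closed (convex hull (weight ` supp T))"
    by (intro compact_imp_closed finite_imp_compact_convex_hull) simp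
  have P: "P \<in> convex hull (weight ` supp T)"
    unfolding P_def using cl ne by (intro closest_point_in_set) auto
  \<comment> \<open>Obtuse angle criterion at the closest point.\<close>
  have Pge: "P \<bullet> P \<le> P \<bullet> weight \<omega>" if "\<omega> \<in> supp T" for \<omega>
  proof -
    have "weight \<omega> \<in> convex hull (weight ` supp T)" using that by (intro hull_inc) auto
    from closest_point_dot[OF convex_convex_hull cl this, of 0]
    have "(0 - P) \<bullet> (weight \<omega> - P) \<le> 0" unfolding P_def .
    then show ?thesis by (simp add: inner_diff_right)
  qed
  define p where "p i = fst P $ i" for i
  define q where "q j = fst (snd P) $ j" for j
  define r where "r k = snd (snd P) $ k" for k
  have PP: "P \<bullet> P = moment_norm p q r"
    by (cases P) (simp add: moment_norm_def p_def q_def r_def inner_vec_def power2_eq_square)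
  define y where "y \<omega> = (cmod (T $ fst \<omega> $ fst (snd \<omega>) $ snd (snd \<omega>)))\<^sup>2" for \<omega>
  have y: "y \<omega> > 0" if "\<omega> \<in> supp T" for \<omega>
    using that by (auto simp: supp_def y_def)
  obtain c :: real and h z where c: "c > 0"
    and lim: "\<And>\<omega>. \<omega> \<in> supp T \<Longrightarrow> (\<lambda>n::nat. c * y \<omega> * exp (h n \<bullet> (weight \<omega> - P))) \<longlonglongrightarrow> z \<omega>"
    and z: "\<And>\<omega>. \<omega> \<in> supp T \<Longrightarrow> z \<omega> \<ge> 0" "(\<Sum>\<omega>\<in>supp T. z \<omega>) = 1" "(\<Sum>\<omega>\<in>supp T. z \<omega> *\<^sub>R weight \<omega>) = P"
    by (rule exp_weight_minimizer[of "supp T" y P weight, OF finite ne y P]) (assumption | rule that)+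
  \<comment> \<open>Exponents are halved because \<open>h\<close> governs squared moduli. The
    constant \<open>c\<close> and the shift by \<open>P\<close> do not depend on the indices and are
    put into the first factor.\<close>
  define \<alpha> where "\<alpha> n i = sqrt c * exp (- (h n \<bullet> P) / 2) * exp (fst (h n) $ i / 2)" for n i
  define \<beta> where "\<beta> n j = exp (fst (snd (h n)) $ j / 2)" for n j
  define \<gamma> where "\<gamma> n k = exp (snd (snd (h n)) $ k / 2)" for n k
  have prod: "(\<alpha> n i * \<beta> n j * \<gamma> n k)\<^sup>2 = c * exp (h n \<bullet> (weight (i,j,k) - P))" for n i j k
  proof -
    have "\<alpha> n i * \<beta> n j * \<gamma> n k = sqrt c * exp (- (h n \<bullet> P) / 2 + fst (h n) $ i / 2
        + fst (snd (h n)) $ j / 2 + snd (snd (h n)) $ k / 2)"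
      unfolding \<alpha>_def \<beta>_def \<gamma>_def exp_add by (simp only: mult.assoc)
    also have "- (h n \<bullet> P) / 2 + fst (h n) $ i / 2 + fst (snd (h n)) $ j / 2 + snd (snd (h n)) $ k / 2
        = (h n \<bullet> (weight (i,j,k) - P)) / 2"
      unfolding inner_diff_right inner_weight by (simp add: field_simps)
    finally show ?thesis using c by (simp add: power_mult_distrib flip: exp_double)
  qed
  have pos: "\<alpha> n i > 0" "\<beta> n j > 0" "\<gamma> n k > 0" for n i j k
    using c by (simp_all add: \<alpha>_def \<beta>_def \<gamma>_def)
  \<comment> \<open>Positive scalings keep phases, so the limit has the phases of \<open>T\<close>
    and the moduli prescribed by \<open>z\<close>.\<close>
  define S where "S = (\<chi> i j k. if (i,j,k) \<in> supp T then of_real (sqrt (z (i,j,k))) * sgn (T $ i $ j $ k) else 0)"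
  have S2: "(cmod (S $ i $ j $ k))\<^sup>2 = (if (i,j,k) \<in> supp T then z (i,j,k) else 0)" for i j k
    using z(1)[of "(i,j,k)"] by (auto simp: S_def norm_mult norm_sgn supp_def)
  have suppS: "supp S \<subseteq> supp T" by (auto simp: supp_def S_def)
  have sumS: "(\<Sum>i\<in>UNIV. \<Sum>j\<in>UNIV. \<Sum>k\<in>UNIV. (cmod (S $ i $ j $ k))\<^sup>2 * g (i,j,k)) = (\<Sum>\<omega>\<in>supp T. z \<omega> * g \<omega>)" for g
    unfolding sum_triple
    by (rule sum.mono_neutral_cong_right) (auto simp: S2)
  have nS: "norm S = 1"
  proof -
    have "(norm S)\<^sup>2 = 1" unfolding norm_tensor_sq using sumS[of "\<lambda>_. 1"] z(2) by simp
    then show ?thesis using norm_ge_zero[of S] unfolding power2_eq_1_iff by linarith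
  qed
  have m1: "(\<Sum>j\<in>UNIV. \<Sum>k\<in>UNIV. (cmod (S $ i $ j $ k))\<^sup>2) = p i" for i
  proof -
    have "p i = (\<Sum>\<omega>\<in>supp T. z \<omega> * fst (weight \<omega>) $ i)"
      unfolding p_def z(3)[symmetric] by (simp add: fst_sum)
    also have "\<dots> = (\<Sum>i'\<in>UNIV. \<Sum>j\<in>UNIV. \<Sum>k\<in>UNIV. (cmod (S $ i' $ j $ k))\<^sup>2 * fst (weight (i',j,k)) $ i)"
      by (rule sumS[symmetric])
    also have "\<dots> = (\<Sum>i'\<in>UNIV. if i = i' then (\<Sum>j\<in>UNIV. \<Sum>k\<in>UNIV. (cmod (S $ i' $ j $ k))\<^sup>2) else 0)"
      by (intro sum.cong refl) (simp add: weight_def axis_def)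
    finally show ?thesis by simp
  qed
  have m2: "(\<Sum>i\<in>UNIV. \<Sum>k\<in>UNIV. (cmod (S $ i $ j $ k))\<^sup>2) = q j" for j
  proof -
    have "q j = (\<Sum>\<omega>\<in>supp T. z \<omega> * fst (snd (weight \<omega>)) $ j)"
      unfolding q_def z(3)[symmetric] by (simp add: fst_sum snd_sum)
    also have "\<dots> = (\<Sum>i\<in>UNIV. \<Sum>j'\<in>UNIV. \<Sum>k\<in>UNIV. (cmod (S $ i $ j' $ k))\<^sup>2 * fst (snd (weight (i,j',k))) $ j)"
      by (rule sumS[symmetric])
    also have "\<dots> = (\<Sum>i\<in>UNIV. \<Sum>j'\<in>UNIV. if j = j' then (\<Sum>k\<in>UNIV. (cmod (S $ i $ j' $ k))\<^sup>2) else 0)"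
      by (intro sum.cong refl) (simp add: weight_def axis_def)
    finally show ?thesis by simp
  qed
  have m3: "(\<Sum>i\<in>UNIV. \<Sum>j\<in>UNIV. (cmod (S $ i $ j $ k))\<^sup>2) = r k" for k
  proof -
    have "r k = (\<Sum>\<omega>\<in>supp T. z \<omega> * snd (snd (weight \<omega>)) $ k)"
      unfolding r_def z(3)[symmetric] by (simp add: snd_sum)
    also have "\<dots> = (\<Sum>i\<in>UNIV. \<Sum>j\<in>UNIV. \<Sum>k'\<in>UNIV. (cmod (S $ i $ j $ k'))\<^sup>2 * snd (snd (weight (i,j,k'))) $ k)"
      by (rule sumS[symmetric])
    also have "\<dots> = (\<Sum>i\<in>UNIV. \<Sum>j\<in>UNIV. \<Sum>k'\<in>UNIV. if k = k' then (cmod (S $ i $ j $ k'))\<^sup>2 else 0)"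
      by (intro sum.cong refl) (simp add: weight_def axis_def)
    finally show ?thesis by simp
  qed
  have freeS: "free_set (supp S)" using free suppS by (rule free_set_mono)
  have mom: "has_moment p q r S"
    using free_gram[OF freeS] unfolding has_moment_def gram_rot_rot_diag m3
    unfolding gram_rot_diag m2 unfolding gram_diag m1 by blast
  have "(\<lambda>n. of_real (\<alpha> n i) * of_real (\<beta> n j) * of_real (\<gamma> n k) * T $ i $ j $ k) \<longlonglongrightarrow> S $ i $ j $ k" for i j k
  proof (cases "(i,j,k) \<in> supp T")
    case True
    have "of_real (\<alpha> n i) * of_real (\<beta> n j) * of_real (\<gamma> n k) * T $ i $ j $ k =
      of_real (sqrt (c * (cmod (T $ i $ j $ k))\<^sup>2 * exp (h n \<bullet> (weight (i,j,k) - P)))) * sgn (T $ i $ j $ k)" for n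
    proof -
      have "c * (cmod (T $ i $ j $ k))\<^sup>2 * exp (h n \<bullet> (weight (i,j,k) - P)) = (\<alpha> n i * \<beta> n j * \<gamma> n k * cmod (T $ i $ j $ k))\<^sup>2"
        using prod[of n i j k] by (simp add: power_mult_distrib)
      then have "sqrt (c * (cmod (T $ i $ j $ k))\<^sup>2 * exp (h n \<bullet> (weight (i,j,k) - P))) = \<alpha> n i * \<beta> n j * \<gamma> n k * cmod (T $ i $ j $ k)"
        using pos[of n] by (simp add: less_imp_le)
      moreover have "T $ i $ j $ k = of_real (cmod (T $ i $ j $ k)) * sgn (T $ i $ j $ k)"
        by (cases "T $ i $ j $ k = 0") (simp_all add: sgn_div_norm scaleR_conv_of_real)
      ultimately show ?thesis by (metis (no_types, lifting) mult.assoc of_real_mult)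
    qed
    moreover have "(\<lambda>n. of_real (sqrt (c * (cmod (T $ i $ j $ k))\<^sup>2 * exp (h n \<bullet> (weight (i,j,k) - P)))) * sgn (T $ i $ j $ k))
      \<longlonglongrightarrow> of_real (sqrt (z (i,j,k))) * sgn (T $ i $ j $ k)"
      using lim[OF True] by (intro tendsto_intros tendsto_real_sqrt) (simp add: y_def)
    ultimately show ?thesis using True by (simp add: S_def)
  qed (simp add: S_def supp_def)
  then have lim: "(\<lambda>n. (diag_matrix (\<lambda>i. of_real (\<alpha> n i)), diag_matrix (\<lambda>j. of_real (\<beta> n j)),
       diag_matrix (\<lambda>k. of_real (\<gamma> n k))) \<bullet>\<^sub>t T) \<longlonglongrightarrow> S"
    by (intro vec_tendstoI) (simp add: act_diag)
  have ge: "moment_norm p q r \<le> p i + q j + r k" if "(i, j, k) \<in> supp T" for i j k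
    using Pge[OF that] by (simp add: PP inner_weight p_def q_def r_def)
  show ?thesis using that[OF pos lim nS mom suppS ge] .
qed

section \<open>Minimal points of the orbit closure\<close>

lemma GL_act_in_orbit: "invertible A \<Longrightarrow> invertible B \<Longrightarrow> invertible C \<Longrightarrow> (A, B, C) \<bullet>\<^sub>t T \<in> GL_orbit T"
  unfolding GL_orbit_def GL_def by blast

lemma unitary_invertible: "unitary_matrix A \<Longrightarrow> invertible A"
  unfolding unitary_matrix_def invertible_def by blast

lemma act_mem_GL_orbit:
  assumes "x \<in> GL_orbit T" "g \<in> GL"
  shows "g \<bullet>\<^sub>t x \<in> GL_orbit T"
proof -
  obtain A B C A' B' C' where "g = (A, B, C)" "invertible A" "invertible B" "invertible C"
    "x = (A', B', C') \<bullet>\<^sub>t T" "invertible A'" "invertible B'" "invertible C'"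
    using assms by (auto simp: GL_orbit_def GL_def)
  then show ?thesis by (simp add: act_act GL_act_in_orbit invertible_mult)
qed

lemma GL_orbit_act:
  assumes "g \<in> GL"
  shows "GL_orbit (g \<bullet>\<^sub>t T) = GL_orbit T"
proof
  obtain A B C where g: "g = (A, B, C)" "invertible A" "invertible B" "invertible C"
    using assms by (auto simp: GL_def)
  then obtain A' B' C' where i: "A' ** A = mat 1" "B' ** B = mat 1" "C' ** C = mat 1"
    "A ** A' = mat 1" "B ** B' = mat 1" "C ** C' = mat 1"
    unfolding invertible_def by blast
  then have "invertible A'" "invertible B'" "invertible C'" by (auto simp: invertible_def)
  then have "(A', B', C') \<bullet>\<^sub>t (g \<bullet>\<^sub>t T) \<in> GL_orbit (g \<bullet>\<^sub>t T)" by (rule GL_act_in_orbit)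
  then have "T \<in> GL_orbit (g \<bullet>\<^sub>t T)" by (simp add: g act_act i act_one)
  then show "GL_orbit T \<subseteq> GL_orbit (g \<bullet>\<^sub>t T)"
    using act_mem_GL_orbit unfolding GL_orbit_def[of T] by blast
  have "g \<bullet>\<^sub>t T \<in> GL_orbit T" using assms unfolding GL_orbit_def by blast
  then show "GL_orbit (g \<bullet>\<^sub>t T) \<subseteq> GL_orbit T"
    using act_mem_GL_orbit unfolding GL_orbit_def[of "g \<bullet>\<^sub>t T"] by blast
qed

lemma closure_GL_orbit_act:
  assumes "R \<in> closure (GL_orbit T)" "g \<in> GL"
  shows "g \<bullet>\<^sub>t R \<in> closure (GL_orbit T)"
proof -
  obtain A B C where g: "g = (A, B, C)" by (cases g)
  obtain x where x: "\<And>n. x n \<in> GL_orbit T" "x \<longlonglongrightarrow> R"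
    using assms(1) unfolding closure_sequential by blast
  have "g \<bullet>\<^sub>t x n \<in> GL_orbit T" for n using x(1) assms(2) by (rule act_mem_GL_orbit)
  moreover have "(\<lambda>n. g \<bullet>\<^sub>t x n) \<longlonglongrightarrow> g \<bullet>\<^sub>t R"
    unfolding g by (intro tendsto_act tendsto_const x(2))
  ultimately show ?thesis
    unfolding closure_sequential by (intro exI[of _ "\<lambda>n. g \<bullet>\<^sub>t x n"]) simp
qed

section \<open>Scaling, and pairing the moment map with diagonal triples\<close>

lemma act_scaleR: "g \<bullet>\<^sub>t (c *\<^sub>R T) = c *\<^sub>R (g \<bullet>\<^sub>t T)"
  by (cases g) (simp add: vec_eq_iff act_def scaleR_sum_right)

lemma scaleR_as_act:
  "(diag_matrix (\<lambda>_. of_real c), mat 1, mat 1) \<bullet>\<^sub>t T = c *\<^sub>R T"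
  by (simp add: vec_eq_iff act_diag scaleR_conv_of_real[where 'a = complex] flip: diag_matrix_one)

lemma gram_scaleR: "gram (c *\<^sub>R T) = (c\<^sup>2) *\<^sub>R gram T"
  by (simp add: gram_def vec_eq_iff scaleR_sum_right power2_eq_square)

lemma rot_scaleR: "rot (c *\<^sub>R T) = c *\<^sub>R rot T"
  by (simp add: rot_def vec_eq_iff)

lemma moment_map_scaleR: "c \<noteq> 0 \<Longrightarrow> moment_map (c *\<^sub>R T) = moment_map T"
  by (simp add: moment_map_eq_gram gram_scaleR rot_scaleR power_mult_distrib)

lemma supp_scaleR: "c \<noteq> 0 \<Longrightarrow> supp (c *\<^sub>R T) = supp T"
  by (simp add: supp_def)

lemma norm_moment_map_act:
  assumes "unitary_matrix A" "unitary_matrix B" "unitary_matrix C" "norm T = 1"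
  shows "norm (moment_map ((A, B, C) \<bullet>\<^sub>t T)) = norm (moment_map T)"
  using assms by (simp add: moment_map_gram norm_act rot_act norm_gram_act norm_Pair)

lemma inner_diag_matrix:
  fixes M :: "complex ^ 'n::finite ^ 'n"
  shows "M \<bullet> diag_matrix (\<lambda>i. of_real (p i)) = (\<Sum>i\<in>UNIV. Re (M $ i $ i) * p i)"
proof -
  have "M $ i $ j \<bullet> (if i = j then complex_of_real (p i) else 0) = (if i = j then Re (M $ i $ i) * p i else 0)" for i j
    by (simp add: inner_complex_def)
  then show ?thesis by (simp add: inner_vec_def diag_matrix_def)
qed

lemma norm_diag_matrix: "(norm (diag_matrix (\<lambda>i. complex_of_real (p i))))\<^sup>2 = (\<Sum>i\<in>UNIV. (p i)\<^sup>2)"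
  unfolding power2_norm_eq_inner inner_diag_matrix by (simp add: diag_matrix_def power2_eq_square)

lemma norm_moment_map_has_moment:
  assumes "has_moment p q r T" "norm T = 1"
  shows "(norm (moment_map T))\<^sup>2 = moment_norm p q r"
  using assms by (simp add: moment_map_gram has_moment_def norm_mat_triple_sq moment_norm_def norm_diag_matrix)

text \<open>Equality case of the Cauchy--Schwarz inequality between \<open>moment_map T\<close> and the diagonal
  triple \<open>(p, q, r)\<close>.\<close>

lemma has_moment_if_minimal:
  fixes T :: "('a::finite, 'b::finite, 'c::finite) tensor3"
  assumes T: "norm T = 1" and le: "(norm (moment_map T))\<^sup>2 \<le> moment_norm p q r"
    and ge: "\<And>i j k. T $ i $ j $ k \<noteq> 0 \<Longrightarrow> moment_norm p q r \<le> p i + q j + r k"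
  shows "has_moment p q r T"
proof -
  define M where "M = (diag_matrix (\<lambda>i. complex_of_real (p i)), diag_matrix (\<lambda>j. complex_of_real (q j)), diag_matrix (\<lambda>k. complex_of_real (r k)))"
  have MM: "M \<bullet> M = moment_norm p q r"
    by (simp add: M_def inner_diag_matrix moment_norm_def power2_eq_square) (simp add: diag_matrix_def)
  have "moment_map T \<bullet> M = (\<Sum>i\<in>UNIV. \<Sum>j\<in>UNIV. \<Sum>k\<in>UNIV. (cmod (T $ i $ j $ k))\<^sup>2 * (p i + q j + r k))"
    unfolding sum_weighted_marginals moment_map_gram[OF T] M_def inner_Pair inner_diag_matrix
      gram_rot_rot_diag unfolding gram_rot_diag unfolding gram_diag by simp
  also have "\<dots> \<ge> (\<Sum>i\<in>UNIV. \<Sum>j\<in>UNIV. \<Sum>k\<in>UNIV. (cmod (T $ i $ j $ k))\<^sup>2 * moment_norm p q r)"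
  proof (intro sum_mono)
    show "(cmod (T $ i $ j $ k))\<^sup>2 * moment_norm p q r \<le> (cmod (T $ i $ j $ k))\<^sup>2 * (p i + q j + r k)" for i j k
      using ge[of i j k] by (cases "T $ i $ j $ k = 0") (auto intro: mult_left_mono)
  qed
  also have "(\<Sum>i\<in>UNIV. \<Sum>j\<in>UNIV. \<Sum>k\<in>UNIV. (cmod (T $ i $ j $ k))\<^sup>2 * moment_norm p q r) = (norm T)\<^sup>2 * moment_norm p q r"
    unfolding norm_tensor_sq by (simp add: sum_distrib_right)
  finally have ip: "moment_norm p q r \<le> moment_map T \<bullet> M" by (simp add: T)
  \<comment> \<open>With N = \<open>moment_norm p q r\<close>, the right-hand side is at most N - 2
    N + N.\<close>
  have "(norm (moment_map T - M))\<^sup>2 = (norm (moment_map T))\<^sup>2 - 2 * (moment_map T \<bullet> M) + M \<bullet> M"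
    unfolding power2_norm_eq_inner by (simp add: inner_diff_left inner_diff_right inner_commute)
  also have "\<dots> \<le> 0" using le ip MM by simp
  finally have "moment_map T = M" by simp
  then show ?thesis by (simp add: moment_map_gram[OF T] M_def has_moment_def)
qed

text \<open>The normalised case: \<open>T\<close> itself has free support and \<open>S\<close> is a
  unit vector.\<close>

lemma minimal_moment_free_support:
  fixes T S :: "('a::finite, 'b::finite, 'c::finite) tensor3"
  assumes free: "free_set (supp T)" and S: "S \<in> closure (GL_orbit T)" "norm S = 1"
    and min: "\<And>R. R \<in> closure (GL_orbit T) - {0} \<Longrightarrow> norm (moment_map S) \<le> norm (moment_map R)"
  obtains k where "k \<in> U" "free_set (supp (k \<bullet>\<^sub>t S))"
proof -
  have T0: "T \<noteq> 0"
  proof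
    assume "T = 0"
    then have "GL_orbit T \<subseteq> {0}" by (auto simp: GL_orbit_def act_def vec_eq_iff)
    then have "closure (GL_orbit T) \<subseteq> {0}" by (intro closure_minimal) auto
    with S show False by auto
  qed
  obtain p q r and \<alpha> \<beta> \<gamma> :: "nat \<Rightarrow> _ \<Rightarrow> real" and R where
    pos: "\<And>n i. \<alpha> n i > 0" "\<And>n j. \<beta> n j > 0" "\<And>n k. \<gamma> n k > 0"
    and lim: "(\<lambda>n. (diag_matrix (\<lambda>i. of_real (\<alpha> n i)), diag_matrix (\<lambda>j. of_real (\<beta> n j)),
       diag_matrix (\<lambda>k. of_real (\<gamma> n k))) \<bullet>\<^sub>t T) \<longlonglongrightarrow> R"
    and R: "norm R = 1" "has_moment p q r R" "supp R \<subseteq> supp T"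
    and ge: "\<And>i j k. (i, j, k) \<in> supp T \<Longrightarrow> moment_norm p q r \<le> p i + q j + r k"
    by (rule free_torus_limit[OF free T0]) (assumption | rule that)+
  let ?N = "moment_norm p q r"
  have "R \<in> closure (GL_orbit T)"
    unfolding closure_sequential using pos
    by (intro exI[of _ "\<lambda>n. (diag_matrix (\<lambda>i. of_real (\<alpha> n i)), diag_matrix (\<lambda>j. of_real (\<beta> n j)), diag_matrix (\<lambda>k. of_real (\<gamma> n k))) \<bullet>\<^sub>t T"] conjI allI lim GL_act_in_orbit invertible_diag_matrix)
      (simp_all add: less_imp_neq[symmetric])
  then have "norm (moment_map S) \<le> norm (moment_map R)" using R(1) by (intro min) auto
  then have S_le: "(norm (moment_map S))\<^sup>2 \<le> ?N"
    using norm_moment_map_has_moment[OF R(2,1)] by (metis norm_ge_zero power_mono)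
  obtain x where x: "\<And>n. x n \<in> GL_orbit T" "x \<longlonglongrightarrow> S"
    using S(1) unfolding closure_sequential by blast
  have "\<exists>A B C. invertible A \<and> invertible B \<and> invertible C \<and> x n = (A, B, C) \<bullet>\<^sub>t T" for n
    using x(1)[of n] by (auto simp: GL_orbit_def GL_def)
  then obtain A B C where ABC: "\<And>n. invertible (A n)" "\<And>n. invertible (B n)" "\<And>n. invertible (C n)"
    "\<And>n. x n = (A n, B n, C n) \<bullet>\<^sub>t T" by metis
  \<comment> \<open>The unitaries depend on n; compactness later replaces them by one limit, which
    is absorbed into \<open>S1\<close>.\<close>
  obtain s where s: "\<And>n. unitary_matrix (s n)" "\<And>n i j. (s n ** A n) $ i $ j \<noteq> 0 \<Longrightarrow> p j \<le> p i"
  proof -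
    have "\<exists>k. unitary_matrix k \<and> (\<forall>i j. (k ** A n) $ i $ j \<noteq> 0 \<longrightarrow> p j \<le> p i)" for n
      using unitary_triangularize[of "A n" p] by metis
    then show ?thesis using that by metis
  qed
  obtain t where t: "\<And>n. unitary_matrix (t n)" "\<And>n i j. (t n ** B n) $ i $ j \<noteq> 0 \<Longrightarrow> q j \<le> q i"
  proof -
    have "\<exists>k. unitary_matrix k \<and> (\<forall>i j. (k ** B n) $ i $ j \<noteq> 0 \<longrightarrow> q j \<le> q i)" for n
      using unitary_triangularize[of "B n" q] by metis
    then show ?thesis using that by metis
  qed
  obtain u where u: "\<And>n. unitary_matrix (u n)" "\<And>n i j. (u n ** C n) $ i $ j \<noteq> 0 \<Longrightarrow> r j \<le> r i"
  proof -
    have "\<exists>k. unitary_matrix k \<and> (\<forall>i j. (k ** C n) $ i $ j \<noteq> 0 \<longrightarrow> r j \<le> r i)" for n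
      using unitary_triangularize[of "C n" r] by metis
    then show ?thesis using that by metis
  qed
  \<comment> \<open>For a constant function the block condition is vacuous, so this is the full
    unitary group.\<close>
  let ?K = "{A. unitary_matrix A \<and> block_diagonal (\<lambda>_. 0) A}"
  have "compact (?K \<times> ?K \<times> ?K :: ('a, 'b, 'c) mat_triple set)"
    by (intro compact_Times compact_block_unitary)
  moreover have "\<forall>n. (s n, t n, u n) \<in> ?K \<times> ?K \<times> ?K"
    using s(1) t(1) u(1) by (simp add: block_diagonal_def)
  ultimately obtain l \<phi> where l: "l \<in> ?K \<times> ?K \<times> ?K" and \<phi>: "strict_mono (\<phi> :: nat \<Rightarrow> nat)"
    "((\<lambda>n. (s n, t n, u n)) \<circ> \<phi>) \<longlonglongrightarrow> l"
    unfolding compact_def by meson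
  obtain s' t' u' where l': "l = (s', t', u')" by (cases l)
  have un: "unitary_matrix s'" "unitary_matrix t'" "unitary_matrix u'" using l by (auto simp: l')
  have lim': "(\<lambda>n. (s (\<phi> n), t (\<phi> n), u (\<phi> n))) \<longlonglongrightarrow> (s', t', u')" using \<phi>(2) by (simp add: o_def l')
  define A' where "A' n = s (\<phi> n) ** A (\<phi> n)" for n
  define B' where "B' n = t (\<phi> n) ** B (\<phi> n)" for n
  define C' where "C' n = u (\<phi> n) ** C (\<phi> n)" for n
  have inv: "invertible (A' n)" "invertible (B' n)" "invertible (C' n)" for n
    unfolding A'_def B'_def C'_def using ABC s(1) t(1) u(1) by (simp_all add: invertible_mult unitary_invertible)
  have tri: "A' n $ i $ i' \<noteq> 0 \<Longrightarrow> p i' \<le> p i" "B' n $ j $ j' \<noteq> 0 \<Longrightarrow> q j' \<le> q j"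
    "C' n $ k $ k' \<noteq> 0 \<Longrightarrow> r k' \<le> r k" for n i i' j j' k k'
    unfolding A'_def B'_def C'_def using s(2) t(2) u(2) by blast+
  define S1 where "S1 = (s', t', u') \<bullet>\<^sub>t S"
  have "(\<lambda>n. (s (\<phi> n), t (\<phi> n), u (\<phi> n)) \<bullet>\<^sub>t x (\<phi> n)) \<longlonglongrightarrow> S1"
    unfolding S1_def
    using tendsto_fst[OF lim'] tendsto_fst[OF tendsto_snd[OF lim']] tendsto_snd[OF tendsto_snd[OF lim']]
      LIMSEQ_subseq_LIMSEQ[OF x(2) \<phi>(1)]
    by (intro tendsto_act) (simp_all add: o_def)
  then have S1: "(\<lambda>n. (A' n, B' n, C' n) \<bullet>\<^sub>t T) \<longlonglongrightarrow> S1"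
    by (simp add: ABC(4) act_act A'_def B'_def C'_def)
  have S1n: "(\<lambda>n. ((A' n, B' n, C' n) \<bullet>\<^sub>t T) $ i $ j $ k) \<longlonglongrightarrow> S1 $ i $ j $ k" for i j k
    by (intro tendsto_vec_nth S1)
  \<comment> \<open>Triangular factors move entries only towards larger values of p, q and r, so
    nothing arrives below the minimal value on the support of \<open>T\<close>.\<close>
  have act0: "((A' n, B' n, C' n) \<bullet>\<^sub>t T) $ i $ j $ k = 0" if "p i + q j + r k < ?N" for n i j k
  proof -
    have "A' n $ i $ i' * B' n $ j $ j' * C' n $ k $ k' * T $ i' $ j' $ k' = 0" for i' j' k'
    proof (rule ccontr)
      assume "\<not> ?thesis"
      then have "p i' \<le> p i" "q j' \<le> q j" "r k' \<le> r k" "?N \<le> p i' + q j' + r k'"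
        using tri ge by (auto simp: supp_def)
      with that show False by linarith
    qed
    then show ?thesis by (simp only: act_nth sum.neutral_const)
  qed
  have S1_ge: "?N \<le> p i + q j + r k" if "S1 $ i $ j $ k \<noteq> 0" for i j k
  proof (rule ccontr)
    assume "\<not> ?thesis"
    then have "(\<lambda>n. ((A' n, B' n, C' n) \<bullet>\<^sub>t T) $ i $ j $ k) = (\<lambda>n. 0)" using act0 by auto
    then have "S1 $ i $ j $ k = 0" using S1n[of i j k] by (simp add: LIMSEQ_const_iff)
    with that show False by simp
  qed
  have nS1: "norm S1 = 1" unfolding S1_def using un S(2) by (simp add: norm_act)
  \<comment> \<open>Minimality enters here: \<open>S1\<close> has the moment norm of
    \<open>S\<close>, which is at most that of \<open>R\<close>.\<close>
  have mS1: "has_moment p q r S1"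
    using nS1 S1_ge S_le un S(2) by (intro has_moment_if_minimal) (auto simp: S1_def norm_moment_map_act)
  have S1_face: "p i + q j + r k = ?N" if "S1 $ i $ j $ k \<noteq> 0" for i j k
    using supp_on_face[OF mS1 nS1 S1_ge that] .
  have R_ge: "?N \<le> p i + q j + r k" if "R $ i $ j $ k \<noteq> 0" for i j k
    using that R(3) by (intro ge) (auto simp: supp_def)
  have R_face: "p i + q j + r k = ?N" if "R $ i $ j $ k \<noteq> 0" for i j k
    using supp_on_face[OF R(2,1) R_ge that] .
  \<comment> \<open>The part of \<open>T\<close> on the face. The torus acts entrywise and
    \<open>R\<close> lives on the face, so the same scalings take \<open>F\<close> to
    \<open>R\<close> in the limit.\<close>
  define F where "F = (\<chi> i j k. if p i + q j + r k = ?N then T $ i $ j $ k else 0)"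
  define y where "y n = (diag_matrix (\<lambda>i. of_real (\<alpha> n i)), diag_matrix (\<lambda>j. of_real (\<beta> n j)), diag_matrix (\<lambda>k. of_real (\<gamma> n k))) \<bullet>\<^sub>t F" for n
  have y: "y \<longlonglongrightarrow> R"
  proof (intro vec_tendstoI)
    fix i j k
    show "(\<lambda>n. y n $ i $ j $ k) \<longlonglongrightarrow> R $ i $ j $ k"
    proof (cases "p i + q j + r k = ?N")
      case True
      then show ?thesis using tendsto_vec_nth[OF tendsto_vec_nth[OF tendsto_vec_nth[OF lim]], of i j k]
        by (simp add: y_def act_diag F_def)
    next
      case False
      then have "R $ i $ j $ k = 0" using R_face by blast
      then show ?thesis using False by (simp add: y_def act_diag F_def)
    qed
  qed
  \<comment> \<open>Inverse torus elements lead from \<open>y n\<close> back to \<open>F\<close>;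
    thus \<open>S1\<close> becomes a limit of group elements applied to a sequence tending to
    \<open>R\<close>.\<close>
  define D1 where "D1 n = diag_matrix (\<lambda>i. complex_of_real (1 / \<alpha> n i))" for n
  define D2 where "D2 n = diag_matrix (\<lambda>i. complex_of_real (1 / \<beta> n i))" for n
  define D3 where "D3 n = diag_matrix (\<lambda>i. complex_of_real (1 / \<gamma> n i))" for n
  have Dinv: "(D1 n, D2 n, D3 n) \<bullet>\<^sub>t y n = F" for n
    using pos by (simp add: vec_eq_iff y_def act_diag D1_def D2_def D3_def less_imp_neq[symmetric])
  \<comment> \<open>On the face, the three triangularity inequalities and the lower bound on the
    support of \<open>T\<close> must all be equalities. So only block entries of the matrices and
    face entries of \<open>T\<close> contribute.\<close>
  have blk: "((block_part p (A' n), block_part q (B' n), block_part r (C' n)) \<bullet>\<^sub>t F) $ i $ j $ k =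
    (if p i + q j + r k = ?N then ((A' n, B' n, C' n) \<bullet>\<^sub>t T) $ i $ j $ k else 0)" for n i j k
  proof -
    have "block_part p (A' n) $ i $ i' * block_part q (B' n) $ j $ j' * block_part r (C' n) $ k $ k' * F $ i' $ j' $ k' =
      (if p i + q j + r k = ?N then A' n $ i $ i' * B' n $ j $ j' * C' n $ k $ k' * T $ i' $ j' $ k' else 0)" for i' j' k'
    proof (cases "A' n $ i $ i' * B' n $ j $ j' * C' n $ k $ k' * T $ i' $ j' $ k' = 0")
      case True
      then show ?thesis by (auto simp: block_part_def F_def)
    next
      case False
      then have le: "p i' \<le> p i" "q j' \<le> q j" "r k' \<le> r k" "?N \<le> p i' + q j' + r k'"
        using tri ge by (auto simp: supp_def)
      show ?thesis
      proof (cases "p i + q j + r k = ?N")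
        case True
        then have "p i' = p i" "q j' = q j" "r k' = r k" using le by linarith+
        then show ?thesis using True by (simp add: block_part_def F_def)
      next
        case False
        then show ?thesis by (auto simp: block_part_def F_def)
      qed
    qed
    then show ?thesis by (simp add: act_nth)
  qed
  have X: "(\<lambda>n. (block_part p (A' n) ** D1 n, block_part q (B' n) ** D2 n, block_part r (C' n) ** D3 n) \<bullet>\<^sub>t y n) \<longlonglongrightarrow> S1"
    unfolding act_act[symmetric] Dinv
  proof (intro vec_tendstoI)
    fix i j k
    show "(\<lambda>n. ((block_part p (A' n), block_part q (B' n), block_part r (C' n)) \<bullet>\<^sub>t F) $ i $ j $ k) \<longlonglongrightarrow> S1 $ i $ j $ k"
    proof (cases "p i + q j + r k = ?N")
      case True
      then show ?thesis unfolding blk using S1n[of i j k] by simp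
    next
      case False
      then have "S1 $ i $ j $ k = 0" using S1_face by blast
      then show ?thesis unfolding blk using False by simp
    qed
  qed
  obtain k where k: "k \<in> U" "k \<bullet>\<^sub>t S1 = R"
  proof (rule kempf_ness_block[OF y X _ _ _ _ _ _ mS1 R(2)])
    show "invertible (block_part p (A' n) ** D1 n)" "invertible (block_part q (B' n) ** D2 n)"
      "invertible (block_part r (C' n) ** D3 n)" for n
      unfolding D1_def D2_def D3_def using pos tri inv
      by (auto intro!: invertible_mult invertible_block_part invertible_diag_matrix simp: less_imp_neq[symmetric])
    show "block_diagonal p (block_part p (A' n) ** D1 n)" "block_diagonal q (block_part q (B' n) ** D2 n)"
      "block_diagonal r (block_part r (C' n) ** D3 n)" for n
      unfolding D1_def D2_def D3_def by (intro block_diagonal_mult block_diagonal_part block_diagonal_diag)+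
  qed
  obtain a b c where abc: "k = (a, b, c)" by (cases k)
  show ?thesis
  proof (rule that)
    show "(a ** s', b ** t', c ** u') \<in> U" using k(1) un by (simp add: abc U_def unitary_mult)
    show "free_set (supp ((a ** s', b ** t', c ** u') \<bullet>\<^sub>t S))"
      using k(2) free_set_mono[OF free R(3)] unfolding abc S1_def act_act by simp
  qed
qed

theorem theorem1p4:
  fixes T S :: "('a::finite, 'b::finite, 'c::finite) tensor3"
  assumes "free_tensor T"
    and "S \<in> closure (GL_orbit T) - {0}"
    and "\<forall>R \<in> closure (GL_orbit T) - {0}. norm (moment_map S) \<le> norm (moment_map R)"
  shows "\<exists>k\<in>U. free_set (supp (k \<bullet>\<^sub>t S))"
proof -
  obtain g where g: "g \<in> GL" "free_set (supp (g \<bullet>\<^sub>t T))" using assms(1) by (auto simp: free_tensor_def)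
  \<comment> \<open>Rescaling \<open>S\<close> changes neither its moment map nor its support, and
    it stays within the orbit closure because nonzero scalars act through \<open>GL\<close>.\<close>
  define c where "c = 1 / norm S"
  have c: "c \<noteq> 0" "norm (c *\<^sub>R S) = 1" using assms(2) by (auto simp: c_def)
  have "(diag_matrix (\<lambda>_. of_real c), mat 1, mat 1) \<in> (GL :: ('a, 'b, 'c) mat_triple set)"
    using c(1) by (auto simp: GL_def invertible_diag_matrix unitary_invertible unitary_mat_1)
  then have S: "c *\<^sub>R S \<in> closure (GL_orbit (g \<bullet>\<^sub>t T))"
    using closure_GL_orbit_act[of S T] assms(2) unfolding GL_orbit_act[OF g(1)] by (metis DiffD1 scaleR_as_act)
  have "norm (moment_map (c *\<^sub>R S)) \<le> norm (moment_map R)" if "R \<in> closure (GL_orbit (g \<bullet>\<^sub>t T)) - {0}" for R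
    using assms(3) that unfolding GL_orbit_act[OF g(1)] moment_map_scaleR[OF c(1)] by blast
  from minimal_moment_free_support[OF g(2) S c(2) this]
  obtain k where "k \<in> U" "free_set (supp (k \<bullet>\<^sub>t (c *\<^sub>R S)))" by blast
  then show ?thesis unfolding act_scaleR supp_scaleR[OF c(1)] by blast
qed

end
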